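(* Let $\vec p=(1,p_2)$ with $1<p_2<\infty$, and let $\vec a,\vec b,\vec c\in\mathbb{R}^2$, $\vec\alpha\in(-1,\infty)^2$. Then the following are equivalent: (1) $S_{\vec a,\vec b,\vec c}$ is bounded from $L^{\vec p}_{\vec\alpha}(T_B\times T_B)$ to $L^\infty(T_B\times T_B)$; (2) $T_{\vec a,\vec b,\vec c}$ is bounded from $L^{\vec p}_{\vec\alpha}(T_B\times T_B)$ to $L^\infty(T_B\times T_B)$; (3) $a_1\ge0$, $a_2>0$, $b_1\ge\alpha_1$, $p_2(b_2+1)>\alpha_2+1$, $c_1=a_1+b_1-\alpha_1$, and $c_2=n+1+a_2+b_2-\frac{n+1+\alpha_2}{p_2}$.
   Context: Let $n$ be a positive integer. For $z=(z_1,\dots,z_n)\in\mathbb{C}^n$ write $z=x+iy$ with $x,y\in\mathbb{R}^n$, $z'=(z_1,\dots,z_{n-1})$, $y'=(y_1,\dots,y_{n-1})$. Let $B=\{y\in\mathbb{R}^n: |y'|^2<y_n\}$ and $T_B=\{x+iy: x\in\mathbb{R}^n, y\in B\}$. For $z\in T_B$ put $\rho(z)=y_n-|y'|^2>0$, and for $z,u\in T_B$ put $\rho(z,u)=\frac14\big(\sum_{j=1}^{n-1}(z_j-\overline{u_j})^2-2i(z_n-\overline{u_n})\big)$; this has positive real part, and complex powers $\rho(z,u)^c$ are taken with the principal branch. $dV$ is Lebesgue measure on $\mathbb{C}^n$ and $dV_\alpha(z)=\rho(z)^\alpha dV(z)$. For $\vec p=(p_1,p_2)\in[1,\infty]^2$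 and $\vec\alpha=(\alpha_1,\alpha_2)$, $L^{\vec p}_{\vec\alpha}(T_B\times T_B)$ is the space of measurable $f$ on $T_B\times T_B$ with finite mixed norm $\|f\|_{\vec p,\vec\alpha}=\big\{\int_{T_B}\big(\int_{T_B}|f(z,w)|^{p_1}dV_{\alpha_1}(z)\big)^{p_2/p_1}dV_{\alpha_2}(w)\big\}^{1/p_2}$, with the inner (resp. outer) integral replaced by an essential supremum in $z$ (resp. $w$) when $p_1=\infty$ (resp. $p_2=\infty$); when $\vec p=(\infty,\infty)$ this is $L^\infty(T_B\times T_B)$. For $\vec a=(a_1,a_2),\vec b=(b_1,b_2),\vec c=(c_1,c_2)\in\mathbb{R}^2$, $T_{\vec a,\vec b,\vec c}f(z,w)=\rho(z)^{a_1}\rho(w)^{a_2}\int_{T_B}\int_{T_B}\frac{\rho(u)^{b_1}\rho(\eta)^{b_2}}{\rho(z,u)^{c_1}\rho(w,\eta)^{c_2}}f(u,\eta)\,dV(u)\,dV(\eta)$ and $S_{\vec a,\vec b,\vec c}f(z,w)=\rho(z)^{a_1}\rho(w)^{a_2}\int_{T_B}\int_{T_B}\frac{\rho(u)^{b_1}\rho(\eta)^{b_2}}{|\rho(z,u)|^{c_1}|\rho(w,\eta)|^{c_2}}f(u,\eta)\,dV(u)\,dV(\eta)$. An operator is bounded from $X$ to $Y$ if for every $f\in X$ the defining integral converges for a.e. $(z,w)$ and $\|Tf\|_Y\le C\|f\|_X$ with $C$ independent of $f$. *)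

theory Defs
  imports "HOL-Analysis.Analysis"
begin

text \<open>C^n is modelled as complex^'n with n = CARD('n); the index k plays the
role of the last coordinate n, the other indices are the primed coordinates.\<close>

definition rho :: "'n::finite \<Rightarrow> complex^'n \<Rightarrow> real" where
  "rho k z = Im (z$k) - (\<Sum>j\<in>UNIV-{k}. (Im (z$j))^2)"

definition TB :: "'n::finite \<Rightarrow> (complex^'n) set" where
  "TB k = {z. rho k z > 0}"

definition rho2 :: "'n::finite \<Rightarrow> complex^'n \<Rightarrow> complex^'n \<Rightarrow> complex" where
  "rho2 k z u = (1/4) * ((\<Sum>j\<in>UNIV-{k}. (z$j - cnj (u$j))^2) - 2 * \<i> * (z$k - cnj (u$k)))"

definition ennpow :: "ennreal \<Rightarrow> real \<Rightarrow> ennreal" where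
  "ennpow x p = (if x = \<infinity> then \<infinity> else ennreal (enn2real x powr p))"

definition mixed_norm_1p :: "'n::finite \<Rightarrow> real \<Rightarrow> real \<times> real
    \<Rightarrow> ((complex^'n) \<times> (complex^'n) \<Rightarrow> complex) \<Rightarrow> ennreal" where
  "mixed_norm_1p k p2 \<alpha> f =
     ennpow (\<integral>\<^sup>+ w \<in> TB k.
        ennpow (\<integral>\<^sup>+ z \<in> TB k. ennreal (cmod (f (z, w)) * rho k z powr fst \<alpha>) \<partial>lborel) p2
          * ennreal (rho k w powr snd \<alpha>) \<partial>lborel) (1 / p2)"

text \<open>Kernels of T and S (without the outer weight rho(z)^a1 rho(w)^a2).\<close>
definition kerT :: "'n::finite \<Rightarrow> real \<times> real \<Rightarrow> real \<times> real
    \<Rightarrow> complex^'n \<Rightarrow> complex^'n \<Rightarrow> complex^'n \<Rightarrow> complex^'n \<Rightarrow> complex" where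
  "kerT k b c z w u \<eta> =
     complex_of_real (rho k u powr fst b * rho k \<eta> powr snd b)
     / (rho2 k z u powr complex_of_real (fst c) * rho2 k w \<eta> powr complex_of_real (snd c))"

definition kerS :: "'n::finite \<Rightarrow> real \<times> real \<Rightarrow> real \<times> real
    \<Rightarrow> complex^'n \<Rightarrow> complex^'n \<Rightarrow> complex^'n \<Rightarrow> complex^'n \<Rightarrow> complex" where
  "kerS k b c z w u \<eta> =
     complex_of_real ((rho k u powr fst b * rho k \<eta> powr snd b)
     / (cmod (rho2 k z u) powr fst c * cmod (rho2 k w \<eta>) powr snd c))"

definition int_op :: "'n::finite \<Rightarrow> real \<times> real
    \<Rightarrow> (complex^'n \<Rightarrow> complex^'n \<Rightarrow> complex^'n \<Rightarrow> complex^'n \<Rightarrow> complex)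
    \<Rightarrow> ((complex^'n) \<times> (complex^'n) \<Rightarrow> complex) \<Rightarrow> complex^'n \<Rightarrow> complex^'n \<Rightarrow> complex" where
  "int_op k a K f z w =
     complex_of_real (rho k z powr fst a * rho k w powr snd a) *
     set_lebesgue_integral lborel (TB k \<times> TB k) (\<lambda>y. K z w (fst y) (snd y) * f y)"

definition bounded_1p_to_Linf :: "'n::finite \<Rightarrow> real \<Rightarrow> real \<times> real \<Rightarrow> real \<times> real
    \<Rightarrow> (complex^'n \<Rightarrow> complex^'n \<Rightarrow> complex^'n \<Rightarrow> complex^'n \<Rightarrow> complex) \<Rightarrow> bool" where
  "bounded_1p_to_Linf k p2 \<alpha> a K \<longleftrightarrow>
     (\<exists>C::real. \<forall>f :: (complex^'n) \<times> (complex^'n) \<Rightarrow> complex.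
        f \<in> borel_measurable lborel \<and> mixed_norm_1p k p2 \<alpha> f < \<infinity> \<longrightarrow>
        (AE x in lborel. x \<in> TB k \<times> TB k \<longrightarrow>
           set_integrable lborel (TB k \<times> TB k) (\<lambda>y. K (fst x) (snd x) (fst y) (snd y) * f y)
           \<and> cmod (int_op k a K f (fst x) (snd x)) \<le> C * enn2real (mixed_norm_1p k p2 \<alpha> f)))"

end

theory Submission
  imports Defs
begin

text \<open>By duality in the mixed norm, boundedness into the space of essentially bounded functions
  says that the modulus of the kernel, divided by the weights, is bounded uniformly in \<open>(z, w)\<close>
  in the dual norm: a supremum in \<open>u\<close> and an \<open>L\<^sup>q\<close> norm in \<open>\<eta>\<close>, where \<open>1/p\<^sub>2 + 1/q = 1\<close>. It factors.
  The supremum is controlled by \<open>Re \<rho>(z,u) \<ge> (\<rho>(z) + \<rho>(u))/2\<close>. The \<open>L\<^sup>q\<close> norm is an integral of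
  \<open>\<rho>(\<eta>)\<^sup>\<beta> / |\<rho>(w,\<eta>)|\<^sup>\<gamma>\<close>; measure preserving shears and a parabolic dilation turn it into
  \<open>J \<rho>(w)\<close> to the power \<open>n + 1 + \<beta> - \<gamma>\<close>, with \<open>J\<close> finite exactly when \<open>\<beta> > -1\<close> and
  \<open>\<gamma> > n + 1 + \<beta>\<close>. For the necessity, images of bounded compactly supported functions are
  continuous, so the bound holds at every point, and the phase of the kernel at one fixed point can be
  absorbed into the test function; hence \<open>S\<close> and \<open>T\<close> obey the same condition.\<close>

section \<open>Lebesgue measure: shears, dilations, one-dimensional integrals\<close>

text \<open>The exceptional null set in the boundedness statement depends on the test function,
  while a test function carrying the phase of the kernel is built for one chosen point (z, w); this
  circularity is why a bound at every point has to be secured before testing. In the second variable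
  put \<open>q = p/(p-1)\<close>, \<open>\<beta> = (b2 - \<alpha>2) q + \<alpha>2\<close>,
  \<open>\<gamma> = c2 q\<close>. Then \<open>\<beta> > -1\<close> is the condition on
  \<open>b2\<close>; equality of the powers of \<open>rho(w)\<close> means
  \<open>n + 1 + \<beta> - \<gamma> = - a2 q\<close>, which is the formula for \<open>c2\<close>;
  given this, \<open>\<gamma> > n + 1 + \<beta>\<close> says \<open>a2 > 0\<close>. The contrast
  between \<open>a1 \<ge> 0\<close>, \<open>b1 \<ge> \<alpha>1\<close> and the strict conditions on
  \<open>a2\<close>, \<open>b2\<close> has this origin: the dual exponent of 1 is infinite, and a
  supremum stays finite at the endpoint where an integral already diverges.\<close>

lemma nn_integral_lborel_shift:
  fixes c :: "'a::euclidean_space"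
  assumes [measurable]: "f \<in> borel_measurable borel"
  shows "(\<integral>\<^sup>+x. f (x + c) \<partial>lborel) = (\<integral>\<^sup>+x. f x \<partial>lborel)"
proof -
  have "(\<integral>\<^sup>+x. f x \<partial>lborel) = (\<integral>\<^sup>+x. f x \<partial>distr lborel borel ((+) c))"
    by (simp add: lborel_distr_plus)
  also have "\<dots> = (\<integral>\<^sup>+x. f (x + c) \<partial>lborel)"
    by (subst nn_integral_distr) (simp_all add: add.commute)
  finally show ?thesis by simp
qed

text \<open>Tonelli along an arbitrary unit direction, without a basis containing \<open>e\<close>:
  multiply by the length 1 of the window of all \<open>s\<close> with
  \<open>x \<bullet> e - s\<close> in [0,1], swap the integrals, and translate by
  \<open>s *\<^sub>R e\<close>, which turns the window into a condition on \<open>x\<close>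
  alone.\<close>

lemma nn_integral_lborel_along:
  fixes e :: "'a::euclidean_space"
  assumes [measurable]: "f \<in> borel_measurable borel" and e: "e \<bullet> e = 1"
  shows "(\<integral>\<^sup>+x. f x \<partial>lborel)
    = (\<integral>\<^sup>+x. indicator {0..1} (x \<bullet> e) * (\<integral>\<^sup>+s. f (x + s *\<^sub>R e) \<partial>lborel) \<partial>lborel)"
proof -
  have one: "(\<integral>\<^sup>+s. indicator {0..1} (x \<bullet> e - s) \<partial>lborel) = (1::ennreal)" for x
  proof -
    have "(\<integral>\<^sup>+s. indicator {0..1} (x \<bullet> e - s) \<partial>lborel)
        = (\<integral>\<^sup>+s. indicator {x \<bullet> e - 1..x \<bullet> e} s \<partial>(lborel::real measure))"
      by (intro nn_integral_cong) (auto split: split_indicator)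
    then show ?thesis by simp
  qed
  have "(\<integral>\<^sup>+x. f x \<partial>lborel) = (\<integral>\<^sup>+x. f x * (\<integral>\<^sup>+s. indicator {0..1} (x \<bullet> e - s) \<partial>lborel) \<partial>lborel)"
    by (simp add: one)
  also have "\<dots> = (\<integral>\<^sup>+x. (\<integral>\<^sup>+s. f x * indicator {0..1} (x \<bullet> e - s) \<partial>lborel) \<partial>lborel)"
    by (subst nn_integral_cmult) auto
  also have "\<dots> = (\<integral>\<^sup>+s. (\<integral>\<^sup>+x. f x * indicator {0..1} (x \<bullet> e - s) \<partial>lborel) \<partial>lborel)"
    by (rule lborel_pair.Fubini'[symmetric]) measurable
  also have "\<dots> = (\<integral>\<^sup>+s. (\<integral>\<^sup>+x. f (x + s *\<^sub>R e) * indicator {0..1} (x \<bullet> e) \<partial>lborel) \<partial>lborel)"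
  proof (rule nn_integral_cong)
    fix s :: real
    show "(\<integral>\<^sup>+x. f x * indicator {0..1} (x \<bullet> e - s) \<partial>lborel)
      = (\<integral>\<^sup>+x. f (x + s *\<^sub>R e) * indicator {0..1} (x \<bullet> e) \<partial>lborel)"
      by (subst nn_integral_lborel_shift[symmetric, where c = "s *\<^sub>R e"])
        (auto simp: inner_add_left e)
  qed
  also have "\<dots> = (\<integral>\<^sup>+x. (\<integral>\<^sup>+s. f (x + s *\<^sub>R e) * indicator {0..1} (x \<bullet> e) \<partial>lborel) \<partial>lborel)"
    by (rule lborel_pair.Fubini') measurable
  also have "\<dots> = (\<integral>\<^sup>+x. indicator {0..1} (x \<bullet> e) * (\<integral>\<^sup>+s. f (x + s *\<^sub>R e) \<partial>lborel) \<partial>lborel)"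
    by (subst nn_integral_cmult[symmetric]) (auto simp: mult.commute)
  finally show ?thesis .
qed

text \<open>On each line in direction \<open>e\<close> the shift \<open>g\<close> is constant, so
  the integral over that line changes only by a translation. This gives Jacobian 1 for nonlinear
  shears without differentiating \<open>g\<close>.\<close>

lemma nn_integral_lborel_shear:
  fixes e :: "'a::euclidean_space"
  assumes [measurable]: "f \<in> borel_measurable borel" "g \<in> borel_measurable borel"
    and e: "e \<bullet> e = 1" and g: "\<And>x s. g (x + s *\<^sub>R e) = g x"
  shows "(\<integral>\<^sup>+x. f (x + g x *\<^sub>R e) \<partial>lborel) = (\<integral>\<^sup>+x. f x \<partial>lborel)"
proof -
  have "(\<integral>\<^sup>+x. f (x + g x *\<^sub>R e) \<partial>lborel) = (\<integral>\<^sup>+x. indicator {0..1} (x \<bullet> e) *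
      (\<integral>\<^sup>+s. f (x + s *\<^sub>R e + g x *\<^sub>R e) \<partial>lborel) \<partial>lborel)"
    by (subst nn_integral_lborel_along[OF _ e]) (auto simp: g)
  also have "\<dots> = (\<integral>\<^sup>+x. indicator {0..1} (x \<bullet> e) * (\<integral>\<^sup>+s. f (x + s *\<^sub>R e) \<partial>lborel) \<partial>lborel)"
  proof (rule nn_integral_cong)
    fix x
    have "(\<integral>\<^sup>+s. f (x + (s + g x) *\<^sub>R e) \<partial>lborel) = (\<integral>\<^sup>+s. f (x + s *\<^sub>R e) \<partial>lborel)"
      by (rule nn_integral_lborel_shift[where f = "\<lambda>s. f (x + s *\<^sub>R e)"]) measurable
    then show "indicator {0..1} (x \<bullet> e) * (\<integral>\<^sup>+s. f (x + s *\<^sub>R e + g x *\<^sub>R e) \<partial>lborel)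
      = indicator {0..1} (x \<bullet> e) * (\<integral>\<^sup>+s. f (x + s *\<^sub>R e) \<partial>lborel)"
      by (simp add: scaleR_add_left add.assoc)
  qed
  also have "\<dots> = (\<integral>\<^sup>+x. f x \<partial>lborel)"
    by (subst nn_integral_lborel_along[OF _ e, where f = f]) auto
  finally show ?thesis .
qed

lemma prod_Basis_complex_vec:
  fixes g :: "complex^'n \<Rightarrow> 'b::comm_monoid_mult"
  shows "(\<Prod>b\<in>Basis. g b) = (\<Prod>i\<in>UNIV. g (axis i 1) * g (axis i \<i>))"
proof -
  have "(\<Prod>b\<in>Basis. g b) = (\<Prod>i\<in>UNIV. \<Prod>b\<in>{axis i 1, axis i \<i>}. g b)"
    unfolding Basis_vec_def Basis_complex_def
    by (subst prod.UNION_disjoint[symmetric])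
      (auto simp: axis_eq_axis intro!: prod.cong)
  also have "\<dots> = (\<Prod>i\<in>UNIV. g (axis i 1) * g (axis i \<i>))"
    by (intro prod.cong) (auto simp: axis_eq_axis)
  finally show ?thesis .
qed

lemma nn_integral_lborel_dilation:
  fixes t :: "'n::finite \<Rightarrow> real"
  assumes [measurable]: "f \<in> borel_measurable borel" and t: "\<And>i. t i > 0"
  shows "(\<integral>\<^sup>+x. f x \<partial>lborel)
    = ennreal (\<Prod>i\<in>UNIV. (t i)\<^sup>2) * (\<integral>\<^sup>+x. f (\<chi> i. t i *\<^sub>R ((x :: complex^'n) $ i)) \<partial>lborel)"
proof -
  \<comment> \<open>The sum picks out the factor of the complex coordinate that carries the basis
    vector: only one entry of \<open>b\<close> is nonzero, and it has norm 1. Each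
    \<open>t i\<close> occurs for two real directions, whence the squares in the Jacobian.\<close>
  define d where "d b = (\<Sum>i\<in>UNIV. t i * norm ((b :: complex^'n) $ i))" for b
  have d: "d (axis i u) = t i * norm u" for i u
    unfolding d_def
    by (subst sum.remove[of UNIV i]) (auto simp: axis_def intro!: sum.neutral)
  define T where "T x = 0 + (\<Sum>b\<in>Basis. (d b * (x \<bullet> b)) *\<^sub>R b)" for x :: "complex^'n"
  have T: "T x = (\<chi> i. t i *\<^sub>R (x $ i))" for x
  proof (rule euclidean_eqI)
    fix b :: "complex^'n" assume b: "b \<in> Basis"
    then obtain i u where "b = axis i u" "u \<in> {1, \<i>}" by (auto simp: Basis_vec_def Basis_complex_def)
    moreover have "T x \<bullet> b = d b * (x \<bullet> b)" using b by (simp add: T_def)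
    ultimately show "T x \<bullet> b = (\<chi> i. t i *\<^sub>R (x $ i)) \<bullet> b"
      by (auto simp: d inner_axis)
  qed
  have "d b \<noteq> 0" if "b \<in> Basis" for b
    using that t by (auto simp: Basis_vec_def Basis_complex_def d less_imp_neq[symmetric])
  then have L: "lborel = density (distr lborel borel T) (\<lambda>_. (\<Prod>b\<in>Basis. \<bar>d b\<bar>))"
    unfolding T_def by (rule lborel_affine_euclidean)
  have P: "(\<Prod>b\<in>Basis. \<bar>d b\<bar>) = (\<Prod>i\<in>UNIV. (t i)\<^sup>2)"
    by (subst prod_Basis_complex_vec) (simp add: d power2_eq_square)
  have [measurable]: "T \<in> borel \<rightarrow>\<^sub>M borel" unfolding T_def by measurable
  show ?thesis
    by (subst L, subst nn_integral_density)
      (simp_all add: P nn_integral_distr nn_integral_cmult T)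
qed

text \<open>Infinitely many disjoint sets, each contributing at least the same
  \<open>\<delta>\<close>, push the integral above every \<open>N * \<delta>\<close>. This is the
  divergence test for the dyadic boxes below.\<close>

lemma nn_integral_eq_top_if_uniform_mass:
  assumes [measurable]: "f \<in> borel_measurable M" "\<And>j::nat. B j \<in> sets M" and dj: "disjoint_family B"
    and lower: "\<And>j x. x \<in> B j \<Longrightarrow> ennreal (m j) \<le> f x"
    and mass: "\<And>j. \<delta> \<le> ennreal (m j) * emeasure M (B j)" and \<delta>: "\<delta> > 0"
  shows "(\<integral>\<^sup>+x. f x \<partial>M) = \<infinity>"
proof -
  have "of_nat N * \<delta> \<le> (\<integral>\<^sup>+x. f x \<partial>M)" for N
  proof -
    have "of_nat N * \<delta> = (\<Sum>j<N. \<delta>)" by simp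
    also have "\<dots> \<le> (\<Sum>j<N. \<integral>\<^sup>+x. ennreal (m j) * indicator (B j) x \<partial>M)"
      by (intro sum_mono) (simp add: nn_integral_cmult_indicator mass)
    also have "\<dots> = (\<integral>\<^sup>+x. (\<Sum>j<N. ennreal (m j) * indicator (B j) x) \<partial>M)"
      by (subst nn_integral_sum) auto
    also have "\<dots> \<le> (\<integral>\<^sup>+x. f x \<partial>M)"
    proof (rule nn_integral_mono)
      fix x
      show "(\<Sum>j<N. ennreal (m j) * indicator (B j) x) \<le> f x"
      proof (cases "\<exists>j<N. x \<in> B j")
        case True
        then obtain j where j: "j < N" "x \<in> B j" by auto
        have "x \<notin> B i" if "i \<noteq> j" for i
          using that dj j by (auto simp: disjoint_family_on_def)
        then have "(\<Sum>j<N. ennreal (m j) * indicator (B j) x) = ennreal (m j)"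
          using j by (subst sum.remove[of _ j]) (auto intro!: sum.neutral)
        then show ?thesis using lower[OF j(2)] by simp
      next
        case False
        then show ?thesis by (subst sum.neutral) auto
      qed
    qed
    finally show ?thesis .
  qed
  moreover have "(SUP N. of_nat N * \<delta>) = (\<infinity>::ennreal)"
    using \<delta> by (subst SUP_mult_right_ennreal[symmetric]) (auto simp: ennreal_SUP_of_nat_eq_top ennreal_top_mult)
  ultimately show ?thesis
    by (metis (mono_tags, lifting) SUP_least infinity_ennreal_def top.extremum_uniqueI)
qed

text \<open>The integrand behaves like \<open>r powr \<beta>\<close> at 0 and like
  \<open>r powr (-1 - \<epsilon>)\<close> at infinity; cutting at 1 reduces the claim to these two
  powers.\<close>

lemma nn_integral_powr_rational_finite:
  fixes \<beta> \<epsilon> :: real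
  assumes "\<beta> > -1" "\<epsilon> > 0"
  shows "(\<integral>\<^sup>+r. ennreal (r powr \<beta> * (1 + r) powr (- (\<beta> + 1 + \<epsilon>))) * indicator {0<..} r \<partial>lborel) < \<infinity>"
proof -
  have A: "(\<integral>\<^sup>+r. ennreal (r powr \<beta>) * indicator {0..1} r \<partial>lborel) < \<infinity>"
    using nn_integral_has_integral_lebesgue[OF _ has_integral_powr_from_0[OF assms(1), of 1]]
    by (simp add: nn_integral_completion ennreal_mult' ennreal_indicator mult.commute)
  have "(\<integral>\<^sup>+r. ennreal (r powr (- 1 - \<epsilon>)) * indicator {1..} r \<partial>lborel) < \<infinity>"
    using nn_integral_has_integral_lebesgue[OF _ has_integral_powr_to_inf[of "-1-\<epsilon>" 1]] assms
    by (simp add: nn_integral_completion ennreal_mult' ennreal_indicator mult.commute)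
  then have B: "(\<integral>\<^sup>+r. ennreal (r powr (- 1 - \<epsilon>)) * indicator {1<..} r \<partial>lborel) < \<infinity>"
    by (rule le_less_trans[rotated]) (auto intro!: nn_integral_mono split: split_indicator)
  have "r powr \<beta> * (1 + r) powr (- (\<beta> + 1 + \<epsilon>)) \<le> r powr \<beta>" if "0 < r" "r \<le> 1" for r
  proof -
    have "(1 + r) powr (- (\<beta> + 1 + \<epsilon>)) \<le> (1 + r) powr 0"
      using assms that by (intro powr_mono) auto
    then show ?thesis using that by (simp add: mult_left_le)
  qed
  moreover have "r powr \<beta> * (1 + r) powr (- (\<beta> + 1 + \<epsilon>)) \<le> r powr (-1-\<epsilon>)" if "1 < r" for r
  proof -
    have "(1 + r) powr (- (\<beta> + 1 + \<epsilon>)) \<le> r powr (- (\<beta> + 1 + \<epsilon>))"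
      using assms that by (intro powr_mono2') auto
    then have "r powr \<beta> * (1 + r) powr (- (\<beta> + 1 + \<epsilon>)) \<le> r powr \<beta> * r powr (- (\<beta> + 1 + \<epsilon>))"
      by (intro mult_left_mono) auto
    also have "\<dots> = r powr (-1-\<epsilon>)" by (simp add: powr_add[symmetric])
    finally show ?thesis .
  qed
  ultimately have "(\<integral>\<^sup>+r. ennreal (r powr \<beta> * (1 + r) powr (- (\<beta> + 1 + \<epsilon>))) * indicator {0<..} r \<partial>lborel)
     \<le> (\<integral>\<^sup>+r. ennreal (r powr \<beta>) * indicator {0..1} r + ennreal (r powr (- 1 - \<epsilon>)) * indicator {1<..} r \<partial>lborel)"
    by (intro nn_integral_mono) (auto split: split_indicator intro!: ennreal_leI)
  also have "\<dots> < \<infinity>" using A B by (subst nn_integral_add) auto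
  finally show ?thesis .
qed

section \<open>The kernel integral\<close>

text \<open>Per coordinate, \<open>(x - x')^2 - (y + y')^2 = |z - u|^2 - 2 y^2 - 2 y'^2\<close>; the
  negative squares are exactly those that turn \<open>Im (z$k) + Im (u$k)\<close> into
  \<open>rho k z + rho k u\<close>. Hence the real part is positive and dominates both
  heights.\<close>

lemma Re_rho2:
  "Re (rho2 k z u) = (\<Sum>j\<in>UNIV-{k}. (cmod (z$j - u$j))\<^sup>2) / 4 + (rho k z + rho k u) / 2"
proof -
  have "Re ((z$j - cnj (u$j))\<^sup>2) = (cmod (z$j - u$j))\<^sup>2 - 2 * (Im (z$j))\<^sup>2 - 2 * (Im (u$j))\<^sup>2" for j
    unfolding cmod_power2 by (simp add: power2_eq_square algebra_simps)
  then have "(\<Sum>j\<in>UNIV-{k}. Re ((z$j - cnj (u$j))\<^sup>2))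
      = (\<Sum>j\<in>UNIV-{k}. (cmod (z$j - u$j))\<^sup>2)
        - 2 * (\<Sum>j\<in>UNIV-{k}. (Im (z$j))\<^sup>2) - 2 * (\<Sum>j\<in>UNIV-{k}. (Im (u$j))\<^sup>2)"
    by (simp only: sum_subtractf sum_distrib_left)
  then show ?thesis by (simp add: rho2_def rho_def field_simps)
qed

text \<open>Affine in \<open>Re (u$k)\<close> with slope 1/2, so twice the imaginary part differs
  from \<open>Re (u$k)\<close> by a function of the other coordinates; a shear can therefore make it
  a coordinate.\<close>

lemma Im_rho2:
  "Im (rho2 k z u) = ((\<Sum>j\<in>UNIV-{k}. (Re (z$j) - Re (u$j)) * (Im (z$j) + Im (u$j)))
     - (Re (z$k) - Re (u$k))) / 2"
proof -
  have "Im ((z$j - cnj (u$j))\<^sup>2) = 2 * ((Re (z$j) - Re (u$j)) * (Im (z$j) + Im (u$j)))" for j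
    by (simp add: power2_eq_square algebra_simps)
  then have "(\<Sum>j\<in>UNIV-{k}. Im ((z$j - cnj (u$j))\<^sup>2))
      = 2 * (\<Sum>j\<in>UNIV-{k}. (Re (z$j) - Re (u$j)) * (Im (z$j) + Im (u$j)))"
    by (simp only: sum_distrib_left)
  then show ?thesis by (simp add: rho2_def diff_divide_distrib)
qed

lemma Re_rho2_ge: "(rho k z + rho k u) / 2 \<le> Re (rho2 k z u)"
  by (simp add: Re_rho2 sum_nonneg)

lemma rho_pos: "z \<in> TB k \<Longrightarrow> 0 < rho k z"
  by (simp add: TB_def)

lemma Re_rho2_pos: "z \<in> TB k \<Longrightarrow> u \<in> TB k \<Longrightarrow> 0 < Re (rho2 k z u)"
  using Re_rho2_ge[of k z u] rho_pos[of z k] rho_pos[of u k] by simp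

lemma rho2_nonzero: "z \<in> TB k \<Longrightarrow> u \<in> TB k \<Longrightarrow> rho2 k z u \<noteq> 0"
  using Re_rho2_pos[of z k u] by auto

lemma cmod_rho2_ge:
  assumes "z \<in> TB k" "u \<in> TB k"
  shows "rho k z / 2 \<le> cmod (rho2 k z u)" "rho k u / 2 \<le> cmod (rho2 k z u)"
  using assms Re_rho2_ge[of k z u] rho_pos[of z k] rho_pos[of u k] complex_Re_le_cmod[of "rho2 k z u"]
  by auto

section \<open>Continuity and measurability of \<open>rho\<close> and \<open>rho2\<close>\<close>

lemma continuous_on_rho [continuous_intros]:
  "continuous_on S f \<Longrightarrow> continuous_on S (\<lambda>x. rho k (f x))"
  unfolding rho_def by (intro continuous_intros)

lemma continuous_on_rho2 [continuous_intros]: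
  "continuous_on S f \<Longrightarrow> continuous_on S g \<Longrightarrow> continuous_on S (\<lambda>x. rho2 k (f x) (g x))"
  unfolding rho2_def by (intro continuous_intros)

lemma open_TB: "open (TB k)"
  unfolding TB_def by (intro open_Collect_less continuous_intros)

lemma borel_measurable_rho [measurable]:
  "f \<in> borel_measurable M \<Longrightarrow> (\<lambda>x. rho k (f x)) \<in> borel_measurable M"
  by (rule borel_measurable_continuous_on[where f = "rho k"]) (auto intro: continuous_intros)

lemma borel_measurable_rho2 [measurable]:
  "f \<in> borel_measurable M \<Longrightarrow> (\<lambda>x. rho2 k z (f x)) \<in> borel_measurable M"
  by (rule borel_measurable_continuous_on[where f = "rho2 k z"]) (auto intro: continuous_intros)

lemma borel_measurable_Re_nth [measurable]:
  "(\<lambda>x. Re (x $ i)) \<in> borel_measurable (borel :: (complex^'n) measure)"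
  by (intro borel_measurable_continuous_onI continuous_intros)

lemma borel_measurable_Im_nth [measurable]:
  "(\<lambda>x. Im (x $ i)) \<in> borel_measurable (borel :: (complex^'n) measure)"
  by (intro borel_measurable_continuous_onI continuous_intros)

lemma sets_TB [measurable]: "TB k \<in> sets borel"
  by (simp add: open_TB)

text \<open>The kernel integrand in Heisenberg-type coordinates centred at \<open>w\<close>, with \<open>s = \<rho>(w)\<close>:
  \<open>Im (x $ k)\<close> stands for \<open>\<rho>(\<eta>)\<close> and \<open>Re (x $ k)\<close> for \<open>2 Im \<rho>(w,\<eta>)\<close>.\<close>

definition model_mod :: "'n::finite \<Rightarrow> real \<Rightarrow> complex^'n \<Rightarrow> real" where
  "model_mod k s x = sqrt (((\<Sum>j\<in>UNIV-{k}. (cmod (x$j))\<^sup>2) / 4 + (s + Im (x$k)) / 2)\<^sup>2 + (Re (x$k) / 2)\<^sup>2)"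

definition model :: "'n::finite \<Rightarrow> real \<Rightarrow> real \<Rightarrow> real \<Rightarrow> complex^'n \<Rightarrow> ennreal" where
  "model k \<beta> \<gamma> s x = ennreal (Im (x$k) powr \<beta> * model_mod k s x powr (-\<gamma>)) * indicator {0<..} (Im (x$k))"

lemma borel_measurable_model [measurable]: "model k \<beta> \<gamma> s \<in> borel_measurable borel"
proof -
  have [measurable]: "model_mod k s \<in> borel_measurable borel"
    unfolding model_mod_def by (intro borel_measurable_continuous_onI continuous_intros) auto
  show ?thesis unfolding model_def by measurable
qed

text \<open>The change to Heisenberg coordinates is split into moves of Jacobian 1: shear the real
  part of the coordinate \<open>k\<close>, shear its imaginary part, translate the other
  coordinates. Afterwards \<open>w\<close> survives only through \<open>rho k w\<close>, which is
  the homogeneity of the level sets of \<open>rho\<close> made explicit.\<close>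

lemma nn_integral_kernel_eq_model:
  fixes k :: "'n::finite"
  shows "(\<integral>\<^sup>+\<eta>\<in>TB k. ennreal (rho k \<eta> powr \<beta> * cmod (rho2 k w \<eta>) powr (-\<gamma>)) \<partial>lborel)
    = (\<integral>\<^sup>+x. model k \<beta> \<gamma> (rho k w) x \<partial>lborel)"
proof -
  define c :: "complex^'n" where "c = (\<chi> j. if j = k then 0 else - (w$j))"
  define e1 :: "complex^'n" where "e1 = axis k 1"
  define e2 :: "complex^'n" where "e2 = axis k \<i>"
  define g2 where "g2 x = - (\<Sum>j\<in>UNIV-{k}. (Im ((x::complex^'n)$j))\<^sup>2)" for x
  \<comment> \<open>Chosen so that \<open>Re (\<eta>$k) + g1 \<eta>\<close> is
    \<open>2 * Im (rho2 k w \<eta>)\<close>; it ignores the coordinate \<open>k\<close> of its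
    argument, as a shear requires.\<close>
  define g1 where "g1 x = (\<Sum>j\<in>UNIV-{k}. (Re (w$j) - Re ((x::complex^'n)$j)) * (Im (w$j) + Im (x$j))) - Re (w$k)" for x
  let ?F = "model k \<beta> \<gamma> (rho k w)"
  have ax [simp]: "(axis k u :: complex^'n) $ k = u" "j \<noteq> k \<Longrightarrow> (axis k u :: complex^'n) $ j = 0" for u j
    by (auto simp: axis_def)
  have e: "e1 \<bullet> e1 = 1" "e2 \<bullet> e2 = 1" by (simp_all add: e1_def e2_def inner_axis)
  have g1: "g1 (x + s *\<^sub>R e1) = g1 x" for x s by (auto simp: g1_def e1_def intro!: sum.cong)
  have g2: "g2 (x + s *\<^sub>R e2) = g2 x" for x s by (auto simp: g2_def e2_def intro!: sum.cong)
  have [measurable]: "g1 \<in> borel_measurable borel" "g2 \<in> borel_measurable borel"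
    unfolding g1_def g2_def by (intro borel_measurable_continuous_onI continuous_intros)+
  have pt: "ennreal (rho k \<eta> powr \<beta> * cmod (rho2 k w \<eta>) powr (-\<gamma>)) * indicator (TB k) \<eta>
      = ?F (\<eta> + g1 \<eta> *\<^sub>R e1 + g2 (\<eta> + g1 \<eta> *\<^sub>R e1) *\<^sub>R e2 + c)" for \<eta>
  proof -
    define y where "y = \<eta> + g1 \<eta> *\<^sub>R e1 + g2 (\<eta> + g1 \<eta> *\<^sub>R e1) *\<^sub>R e2 + c"
    have "g2 (\<eta> + g1 \<eta> *\<^sub>R e1) = g2 \<eta>"
      by (auto simp: g2_def e1_def intro!: sum.cong)
    then have y: "Im (y$k) = rho k \<eta>" "Re (y$k) = Re (\<eta>$k) + g1 \<eta>" "\<And>j. j \<noteq> k \<Longrightarrow> y$j = \<eta>$j - w$j"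
      by (simp_all add: y_def c_def e1_def e2_def g2_def rho_def)
    have "Re (y$k) / 2 = Im (rho2 k w \<eta>)" by (simp add: y Im_rho2 g1_def)
    moreover have "(\<Sum>j\<in>UNIV-{k}. (cmod (y$j))\<^sup>2) / 4 + (rho k w + Im (y$k)) / 2 = Re (rho2 k w \<eta>)"
      by (auto simp: y Re_rho2 norm_minus_commute intro!: sum.cong)
    ultimately have "model_mod k (rho k w) y = cmod (rho2 k w \<eta>)"
      by (simp add: model_mod_def cmod_def)
    then show ?thesis unfolding y_def[symmetric] by (simp add: model_def y TB_def indicator_def)
  qed
  have "(\<integral>\<^sup>+x. ?F x \<partial>lborel) = (\<integral>\<^sup>+x. ?F (x + c) \<partial>lborel)"
    by (subst nn_integral_lborel_shift) auto
  also have "\<dots> = (\<integral>\<^sup>+x. ?F (x + g2 x *\<^sub>R e2 + c) \<partial>lborel)"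
    by (subst nn_integral_lborel_shear[where f = "\<lambda>x. ?F (x + c)" and g = g2 and e = e2]) (auto simp: e g2)
  also have "\<dots> = (\<integral>\<^sup>+x. ?F (x + g1 x *\<^sub>R e1 + g2 (x + g1 x *\<^sub>R e1) *\<^sub>R e2 + c) \<partial>lborel)"
    by (subst nn_integral_lborel_shear[where f = "\<lambda>x. ?F (x + g2 x *\<^sub>R e2 + c)" and g = g1 and e = e1])
      (auto simp: e g1)
  finally show ?thesis by (simp add: pt)
qed

text \<open>The modulus is homogeneous of degree 1 when the coordinate \<open>k\<close> and the
  parameter scale by \<open>s\<close> and the other coordinates by \<open>sqrt s\<close>, so the
  integrand gains \<open>s powr (\<beta> - \<gamma>)\<close>. The Jacobian
  \<open>s^2 * s^(n-1)\<close> supplies the \<open>n + 1\<close>.\<close>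

lemma nn_integral_model_scale:
  fixes k :: "'n::finite"
  assumes s: "s > 0"
  shows "(\<integral>\<^sup>+x. model k \<beta> \<gamma> s x \<partial>lborel)
    = ennreal (s powr (real CARD('n) + 1 + \<beta> - \<gamma>)) * (\<integral>\<^sup>+x. model k \<beta> \<gamma> 1 x \<partial>lborel)"
proof -
  define t where "t i = (if i = k then s else sqrt s)" for i :: 'n
  have t: "t i > 0" for i using s by (simp add: t_def)
  have pr: "(\<Prod>i\<in>UNIV. (t i)\<^sup>2) = s powr (real CARD('n) + 1)"
  proof -
    have "(\<Prod>i\<in>UNIV. (t i)\<^sup>2) = s\<^sup>2 * s ^ (CARD('n) - 1)"
      using s by (subst prod.remove[of _ k]) (auto simp: t_def card_Diff_singleton)
    also have "\<dots> = s ^ (CARD('n) + 1)"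
      by (subst power_add[symmetric]) (metis Suc_diff_1 add_2_eq_Suc add.commute Suc_eq_plus1 finite_UNIV_card_ge_0 finite_code)
    also have "\<dots> = s powr (real CARD('n) + 1)" using s by (subst powr_realpow[symmetric]) (auto simp: add.commute)
    finally show ?thesis .
  qed
  have "model_mod k s (\<chi> i. t i *\<^sub>R (x $ i)) = s * model_mod k 1 x" for x
  proof -
    have "(\<Sum>j\<in>UNIV-{k}. (cmod ((\<chi> i. t i *\<^sub>R (x $ i))$j))\<^sup>2) = s * (\<Sum>j\<in>UNIV-{k}. (cmod (x$j))\<^sup>2)"
      using s by (auto simp: t_def sum_distrib_left power_mult_distrib intro!: sum.cong)
    then have "model_mod k s (\<chi> i. t i *\<^sub>R (x $ i)) = sqrt (s\<^sup>2 * (((\<Sum>j\<in>UNIV-{k}. (cmod (x$j))\<^sup>2) / 4 + (1 + Im (x$k)) / 2)\<^sup>2 + (Re (x$k) / 2)\<^sup>2))"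
      unfolding model_mod_def by (simp add: t_def) (simp add: power2_eq_square field_simps)
    then show ?thesis using s by (simp add: real_sqrt_mult model_mod_def)
  qed
  then have "model k \<beta> \<gamma> s (\<chi> i. t i *\<^sub>R (x $ i)) = ennreal (s powr (\<beta> - \<gamma>)) * model k \<beta> \<gamma> 1 x" for x
    using s by (auto simp: model_def t_def powr_mult powr_diff powr_minus field_simps ennreal_mult'[symmetric]
      zero_less_mult_iff model_mod_def split: split_indicator)
  then have "(\<integral>\<^sup>+x. model k \<beta> \<gamma> s x \<partial>lborel)
     = ennreal (s powr (real CARD('n) + 1)) * (ennreal (s powr (\<beta> - \<gamma>)) * (\<integral>\<^sup>+x. model k \<beta> \<gamma> 1 x \<partial>lborel))"
    by (subst nn_integral_lborel_dilation[where t = t]) (auto simp: t pr nn_integral_cmult)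
  also have "\<dots> = ennreal (s powr (real CARD('n) + 1 + \<beta> - \<gamma>)) * (\<integral>\<^sup>+x. model k \<beta> \<gamma> 1 x \<partial>lborel)"
    by (simp add: mult.assoc[symmetric] ennreal_mult'[symmetric] powr_add[symmetric] algebra_simps)
  finally show ?thesis .
qed

section \<open>Convergence and divergence of the model integral\<close>

lemma AE_lborel_open_ex:
  fixes U :: "'a::euclidean_space set"
  assumes "AE x in lborel. P x" "open U" "U \<noteq> {}"
  shows "\<exists>x\<in>U. P x"
proof (rule ccontr)
  assume "\<not> (\<exists>x\<in>U. P x)"
  then have "AE x in lborel. x \<notin> U" using assms(1) by (auto elim: eventually_mono)
  then have "emeasure lborel U = 0" using assms(2) by (subst (asm) AE_iff_measurable[of U]) auto
  then have "U \<in> null_sets lebesgue"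
    using assms(2) by (auto simp: null_sets_completionI)
  then show False using open_not_negligible[OF assms(2,3)] by (simp add: negligible_iff_null_sets)
qed

text \<open>For \<open>A \<ge> 0\<close>, \<open>sqrt (A^2 + B^2)\<close> lies above
  \<open>A\<close> and \<open>|B|\<close> and below their sum. The constant 8 is not sharp: the left
  side is at most \<open>4 A + 2 |B|\<close>, which already gives 6.\<close>

lemma model_mod_bounds:
  assumes "s > 0" "Im (x$k) > 0"
  shows "(s + Im (x$k)) / 2 \<le> model_mod k s x"
    "(1 + (\<Sum>j\<in>UNIV-{k}. (cmod (x$j))\<^sup>2) + Im (x$k) + \<bar>Re (x$k)\<bar>) \<le> 8 * model_mod k 1 x"
    "model_mod k s x \<le> (\<Sum>j\<in>UNIV-{k}. (cmod (x$j))\<^sup>2) / 4 + (s + Im (x$k)) / 2 + \<bar>Re (x$k)\<bar> / 2"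
proof -
  define S where "S = (\<Sum>j\<in>UNIV-{k}. (cmod (x$j))\<^sup>2)"
  have S: "S \<ge> 0" by (simp add: S_def sum_nonneg)
  have ge: "S/4 + (s + Im (x$k)) / 2 \<le> model_mod k s x" "\<bar>Re (x$k)\<bar> / 2 \<le> model_mod k s x" for s
  proof -
    show "S/4 + (s + Im (x$k)) / 2 \<le> model_mod k s x"
      unfolding model_mod_def S_def[symmetric] by (rule real_sqrt_sum_squares_ge1)
    show "\<bar>Re (x$k)\<bar> / 2 \<le> model_mod k s x"
      unfolding model_mod_def by (rule real_le_rsqrt) (simp add: power_divide)
  qed
  show "(s + Im (x$k)) / 2 \<le> model_mod k s x" using ge(1)[of s] S by linarith
  show "(1 + (\<Sum>j\<in>UNIV-{k}. (cmod (x$j))\<^sup>2) + Im (x$k) + \<bar>Re (x$k)\<bar>) \<le> 8 * model_mod k 1 x"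
    unfolding S_def[symmetric] using ge[of 1] S assms abs_ge_zero[of "Re (x$k)"] by (simp add: field_simps)
  have "model_mod k s x \<le> \<bar>S/4 + (s + Im (x$k)) / 2\<bar> + \<bar>Re (x$k) / 2\<bar>"
    unfolding model_mod_def S_def[symmetric] by (rule sqrt_sum_squares_le_sum_abs)
  then show "model_mod k s x \<le> (\<Sum>j\<in>UNIV-{k}. (cmod (x$j))\<^sup>2) / 4 + (s + Im (x$k)) / 2 + \<bar>Re (x$k)\<bar> / 2"
    unfolding S_def[symmetric] using S assms by simp
qed

lemma nn_integral_even_finite:
  fixes h :: "real \<Rightarrow> real"
  assumes [measurable]: "h \<in> borel_measurable borel" and even: "\<And>x. h (-x) = h x"
    and fin: "(\<integral>\<^sup>+x. ennreal (h x) * indicator {0<..} x \<partial>lborel) < \<infinity>"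
  shows "(\<integral>\<^sup>+x. ennreal (h x) \<partial>lborel) < \<infinity>"
proof -
  have neg: "(\<integral>\<^sup>+x. ennreal (h x) * indicator {..<0} x \<partial>lborel) = (\<integral>\<^sup>+x. ennreal (h x) * indicator {0<..} x \<partial>lborel)"
    by (subst nn_integral_real_affine[where c = "-1" and t = 0])
      (auto simp: even intro!: nn_integral_cong split: split_indicator)
  have "(\<integral>\<^sup>+x. ennreal (h x) \<partial>lborel)
    = (\<integral>\<^sup>+x. ennreal (h x) * indicator {0<..} x + ennreal (h x) * indicator {..<0} x \<partial>lborel)"
  proof (rule nn_integral_cong_AE)
    show "AE x in lborel. ennreal (h x) = ennreal (h x) * indicator {0<..} x + ennreal (h x) * indicator {..<0} x"
      using AE_lborel_singleton[of "0::real"] by eventually_elim (auto split: split_indicator)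
  qed
  also have "\<dots> < \<infinity>" using fin by (subst nn_integral_add) (auto simp: neg)
  finally show ?thesis .
qed

text \<open>The decay of order \<open>\<gamma>\<close> is distributed over the 2n real coordinates,
  each receiving slightly more than convergence in one variable demands; the resulting product is
  integrated coordinate by coordinate.\<close>

lemma nn_integral_model_finite:
  fixes k :: "'n::finite"
  assumes \<beta>: "\<beta> > -1" and \<gamma>: "\<gamma> > real CARD('n) + 1 + \<beta>"
  shows "(\<integral>\<^sup>+x. model k \<beta> \<gamma> 1 x \<partial>lborel) < \<infinity>"
proof -
  \<comment> \<open>The surplus of \<open>\<gamma>\<close> over the critical exponent, in 2n equal
    shares. The critical shares are 1 for \<open>Re (x$k)\<close>, \<open>\<beta> + 1\<close> for
    \<open>Im (x$k)\<close>, and 1/2 for each of the other 2n - 2 real coordinates (as a power of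
    \<open>1 + v^2\<close>); they add up to \<open>n + 1 + \<beta>\<close>.\<close>
  define \<epsilon> where "\<epsilon> = (\<gamma> - (real CARD('n) + 1 + \<beta>)) / (2 * real CARD('n))"
  have \<epsilon>: "\<epsilon> > 0" using \<gamma> by (simp add: \<epsilon>_def)
  define p1 where "p1 v = (1 + \<bar>v\<bar>) powr (- (1 + \<epsilon>))" for v :: real
  define p2 where "p2 r = r powr \<beta> * (1 + r) powr (- (\<beta> + 1 + \<epsilon>))" for r :: real
  define p3 where "p3 v = (1 + v\<^sup>2) powr (- (1/2 + \<epsilon>))" for v :: real
  define \<phi> where "\<phi> b = (\<lambda>v. if b = axis k 1 then ennreal (p1 v) else
     if b = axis k \<i> then ennreal (p2 v) * indicator {0<..} v else ennreal (p3 v))" for b :: "complex^'n"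
  have [measurable]: "p1 \<in> borel_measurable borel" "p2 \<in> borel_measurable borel" "p3 \<in> borel_measurable borel"
    unfolding p1_def p2_def p3_def by measurable
  have [measurable]: "\<phi> b \<in> borel_measurable borel" for b
    unfolding \<phi>_def by measurable
  have i2: "(\<integral>\<^sup>+v. ennreal (p2 v) * indicator {0<..} v \<partial>lborel) < \<infinity>"
    unfolding p2_def using nn_integral_powr_rational_finite[OF \<beta> \<epsilon>] .
  have line: "(\<integral>\<^sup>+v. ennreal ((1 + \<bar>v\<bar>) powr (- (1 + \<epsilon>'))) \<partial>lborel) < \<infinity>" if "\<epsilon>' > 0" for \<epsilon>' :: real
  proof (rule nn_integral_even_finite)
    have "(\<integral>\<^sup>+x. ennreal ((1 + \<bar>x\<bar>) powr - (1 + \<epsilon>')) * indicator {0<..} x \<partial>lborel)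
       = (\<integral>\<^sup>+r. ennreal (r powr 0 * (1 + r) powr (- (0 + 1 + \<epsilon>'))) * indicator {0<..} r \<partial>lborel)"
      by (intro nn_integral_cong) (auto split: split_indicator)
    then show "(\<integral>\<^sup>+x. ennreal ((1 + \<bar>x\<bar>) powr - (1 + \<epsilon>')) * indicator {0<..} x \<partial>lborel) < \<infinity>"
      using nn_integral_powr_rational_finite[of 0 \<epsilon>'] that by simp
  qed auto
  have i1: "(\<integral>\<^sup>+v. ennreal (p1 v) \<partial>lborel) < \<infinity>"
    unfolding p1_def using line[OF \<epsilon>] .
  have i3: "(\<integral>\<^sup>+v. ennreal (p3 v) \<partial>lborel) < \<infinity>"
  proof -
    have "p3 v \<le> 2 powr (1/2 + \<epsilon>) * (1 + \<bar>v\<bar>) powr (- (1 + 2*\<epsilon>))" for v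
    proof -
      have "2 * \<bar>v\<bar> \<le> 1 + v\<^sup>2" using zero_le_power2[of "\<bar>v\<bar> - 1"] by (simp add: power2_eq_square algebra_simps)
      then have "(1 + \<bar>v\<bar>)\<^sup>2 / 2 \<le> 1 + v\<^sup>2" by (simp add: power2_eq_square algebra_simps)
      then have "p3 v \<le> ((1 + \<bar>v\<bar>)\<^sup>2 / 2) powr (- (1/2 + \<epsilon>))"
        unfolding p3_def using \<epsilon> by (intro powr_mono2') auto
      also have "\<dots> = 2 powr (1/2 + \<epsilon>) * ((1 + \<bar>v\<bar>) powr 2) powr (- (1/2 + \<epsilon>))"
        by (subst powr_divide) (auto simp: powr_minus field_simps)
      also have "\<dots> = 2 powr (1/2 + \<epsilon>) * (1 + \<bar>v\<bar>) powr (- (1 + 2*\<epsilon>))"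
        unfolding powr_powr by (simp add: algebra_simps minus_diff_commute)
      finally show ?thesis .
    qed
    then have "(\<integral>\<^sup>+v. ennreal (p3 v) \<partial>lborel)
        \<le> (\<integral>\<^sup>+v. ennreal (2 powr (1/2 + \<epsilon>)) * ennreal ((1 + \<bar>v\<bar>) powr (- (1 + 2*\<epsilon>))) \<partial>lborel)"
      by (intro nn_integral_mono) (simp add: ennreal_mult'[symmetric] ennreal_leI)
    also have "\<dots> < \<infinity>"
      using line[of "2*\<epsilon>"] \<epsilon> by (subst nn_integral_cmult) (auto simp: ennreal_mult_less_top)
    finally show ?thesis .
  qed
  have bound: "model k \<beta> \<gamma> 1 x \<le> ennreal (8 powr \<gamma>) * (\<Prod>b\<in>Basis. \<phi> b (x \<bullet> b))" for x
  proof (cases "Im (x$k) > 0")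
    case False
    then show ?thesis by (simp add: model_def)
  next
    case True
    define S where "S = (\<Sum>j\<in>UNIV-{k}. (cmod (x$j))\<^sup>2)"
    \<comment> \<open>A common majorant: \<open>1 + |Re (x$k)|\<close>, \<open>1 + Im (x$k)\<close>
      and every \<open>1 + v^2\<close> are at most \<open>N\<close>, while \<open>N / 8\<close>
      bounds the modulus from below.\<close>
    define N where "N = 1 + S + Im (x$k) + \<bar>Re (x$k)\<bar>"
    have S: "S \<ge> 0" by (simp add: S_def sum_nonneg)
    have N1: "N \<ge> 1" using S True by (simp add: N_def)
    have "model_mod k 1 x \<ge> N / 8"
      using model_mod_bounds(2)[of 1 x k] True by (simp add: N_def S_def)
    then have "model_mod k 1 x powr (-\<gamma>) \<le> (N / 8) powr (-\<gamma>)"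
      using \<beta> \<gamma> N1 by (intro powr_mono2') auto
    also have "\<dots> = 8 powr \<gamma> * N powr (-\<gamma>)"
      using N1 by (simp add: powr_divide powr_minus field_simps)
    finally have mm: "model_mod k 1 x powr (-\<gamma>) \<le> 8 powr \<gamma> * N powr (-\<gamma>)" .
    have \<gamma>eq: "-\<gamma> = - (1 + \<epsilon>) + - (\<beta> + 1 + \<epsilon>) + (real (CARD('n) - 1)) * (2 * - (1/2 + \<epsilon>))"
    proof -
      have "real (CARD('n) - 1) = real CARD('n) - 1" by (simp add: of_nat_diff)
      moreover have "2 * real CARD('n) * \<epsilon> = \<gamma> - (real CARD('n) + 1 + \<beta>)" by (simp add: \<epsilon>_def)
      ultimately show ?thesis by (simp add: algebra_simps)
    qed
    have "N powr (-\<gamma>) = N powr (- (1 + \<epsilon>)) * N powr (- (\<beta> + 1 + \<epsilon>)) * (\<Prod>j\<in>UNIV-{k}. N powr (- (1/2 + \<epsilon>)) * N powr (- (1/2 + \<epsilon>)))"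
    proof -
      have "(\<Prod>j\<in>UNIV-{k}. N powr (- (1/2 + \<epsilon>)) * N powr (- (1/2 + \<epsilon>))) = (N powr (2 * - (1/2 + \<epsilon>))) ^ (CARD('n) - 1)"
        by (simp add: card_Diff_singleton powr_add[symmetric])
      also have "\<dots> = N powr (real (CARD('n) - 1) * (2 * - (1/2 + \<epsilon>)))"
        using N1 by (subst powr_realpow[symmetric]) (auto simp: powr_powr mult.commute)
      finally show ?thesis unfolding \<gamma>eq by (simp only: powr_add)
    qed
    also have "\<dots> \<le> p1 (Re (x$k)) * (1 + Im (x$k)) powr (- (\<beta> + 1 + \<epsilon>)) * (\<Prod>j\<in>UNIV-{k}. p3 (Re (x$j)) * p3 (Im (x$j)))"
    proof (intro mult_mono prod_mono conjI prod_nonneg)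
      show "N powr (- (1 + \<epsilon>)) \<le> p1 (Re (x$k))"
        unfolding p1_def using \<epsilon> S True by (intro powr_mono2') (auto simp: N_def)
      show "N powr (- (\<beta> + 1 + \<epsilon>)) \<le> (1 + Im (x$k)) powr (- (\<beta> + 1 + \<epsilon>))"
        using \<epsilon> \<beta> S True by (intro powr_mono2') (auto simp: N_def)
      fix j assume j: "j \<in> UNIV - {k}"
      have "(cmod (x$j))\<^sup>2 \<le> S" unfolding S_def using j by (intro member_le_sum) auto
      then have le: "1 + (Re (x$j))\<^sup>2 \<le> N" "1 + (Im (x$j))\<^sup>2 \<le> N"
        using True unfolding cmod_power2 N_def by (auto intro: add_mono order_trans) (smt (verit) zero_le_power2)+
      show "N powr (- (1/2 + \<epsilon>)) \<le> p3 (Re (x$j))" "N powr (- (1/2 + \<epsilon>)) \<le> p3 (Im (x$j))"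
        unfolding p3_def using le \<epsilon> by (auto intro!: powr_mono2' add_pos_nonneg)
    qed (auto simp: p1_def p3_def)
    finally have "Im (x$k) powr \<beta> * model_mod k 1 x powr (-\<gamma>) \<le> Im (x$k) powr \<beta> * (8 powr \<gamma> *
        (p1 (Re (x$k)) * (1 + Im (x$k)) powr (- (\<beta> + 1 + \<epsilon>)) * (\<Prod>j\<in>UNIV-{k}. p3 (Re (x$j)) * p3 (Im (x$j)))))"
      using mm by (intro mult_left_mono) (auto intro: order_trans mult_left_mono)
    also have "\<dots> = 8 powr \<gamma> * (p1 (Re (x$k)) * p2 (Im (x$k)) * (\<Prod>j\<in>UNIV-{k}. p3 (Re (x$j)) * p3 (Im (x$j))))"
      by (simp add: p2_def)
    finally have "model k \<beta> \<gamma> 1 x \<le> ennreal (8 powr \<gamma> * (p1 (Re (x$k)) * p2 (Im (x$k)) * (\<Prod>j\<in>UNIV-{k}. p3 (Re (x$j)) * p3 (Im (x$j)))))"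
      using True by (simp add: model_def ennreal_leI)
    also have "\<dots> = ennreal (8 powr \<gamma>) * (\<Prod>b\<in>Basis. \<phi> b (x \<bullet> b))"
    proof -
      have "(\<Prod>b\<in>Basis. \<phi> b (x \<bullet> b)) = (\<Prod>i\<in>UNIV. \<phi> (axis i 1) (Re (x$i)) * \<phi> (axis i \<i>) (Im (x$i)))"
        by (subst prod_Basis_complex_vec) (simp add: inner_axis)
      also have "\<dots> = \<phi> (axis k 1) (Re (x$k)) * \<phi> (axis k \<i>) (Im (x$k)) *
          (\<Prod>i\<in>UNIV-{k}. \<phi> (axis i 1) (Re (x$i)) * \<phi> (axis i \<i>) (Im (x$i)))"
        by (subst prod.remove[of _ k]) auto
      also have "\<dots> = ennreal (p1 (Re (x$k))) * ennreal (p2 (Im (x$k))) * (\<Prod>i\<in>UNIV-{k}. ennreal (p3 (Re (x$i)) * p3 (Im (x$i))))"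
        using True by (auto simp: \<phi>_def axis_eq_axis ennreal_mult' p3_def intro!: prod.cong arg_cong2[where f = times])
      also have "\<dots> = ennreal (p1 (Re (x$k)) * p2 (Im (x$k)) * (\<Prod>j\<in>UNIV-{k}. p3 (Re (x$j)) * p3 (Im (x$j))))"
        by (subst prod_ennreal) (auto simp: p1_def p2_def p3_def ennreal_mult'' prod_nonneg)
      finally show ?thesis by (simp add: ennreal_mult')
    qed
    finally show ?thesis .
  qed
  have "(\<integral>\<^sup>+x. model k \<beta> \<gamma> 1 x \<partial>lborel) \<le> (\<integral>\<^sup>+x. ennreal (8 powr \<gamma>) * (\<Prod>b\<in>Basis. \<phi> b (x \<bullet> b)) \<partial>lborel)"
    by (intro nn_integral_mono bound)
  also have "\<dots> = ennreal (8 powr \<gamma>) * (\<Prod>b\<in>Basis. (\<integral>\<^sup>+x. \<phi> b x \<partial>lborel))"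
    by (subst nn_integral_cmult) (auto simp: nn_integral_lborel_prod)
  also have "\<dots> < \<infinity>"
  proof -
    have "(\<integral>\<^sup>+x. \<phi> b x \<partial>lborel) < \<infinity>" for b
      using i1 i2 i3 by (cases "b = axis k 1"; cases "b = axis k \<i>") (simp_all add: \<phi>_def)
    then have "(\<integral>\<^sup>+x. \<phi> b x \<partial>lborel) \<noteq> top" for b
      by (metis infinity_ennreal_def less_irrefl)
    then have "(\<Prod>b\<in>Basis. (\<integral>\<^sup>+x. \<phi> b x \<partial>lborel)) \<noteq> top"
      by (simp add: ennreal_prod_eq_top)
    then show ?thesis by (simp add: ennreal_mult_less_top top.not_eq_extremum)
  qed
  finally show ?thesis .
qed

text \<open>On the box with \<open>|Re (x$k)| < s\<close>, \<open>r < Im (x$k) < 2 r\<close> and the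
  other real coordinates below \<open>sqrt s\<close> in absolute value, the modulus is comparable to
  \<open>s\<close>, so the integrand is of order \<open>s powr (-\<gamma>) * r powr \<beta>\<close>
  on a volume of order \<open>r * s^n\<close>. Small \<open>r\<close> with \<open>s = 1\<close>
  probes the boundary, \<open>r = s\<close> probes infinity.\<close>

lemma nn_integral_model_box_mass:
  fixes k :: "'n::finite"
  shows "\<exists>\<kappa>>0. \<forall>s r. 1 \<le> s \<and> 0 < r \<and> r \<le> s \<and> (s = 1 \<or> r = s) \<longrightarrow>
    (\<exists>B\<in>sets lborel. B \<subseteq> {x::complex^'n. r < Im (x$k) \<and> Im (x$k) < 2 * r} \<and>
      (\<forall>x\<in>B. ennreal (\<kappa> * (s powr (-\<gamma>) * r powr \<beta>)) \<le> model k \<beta> \<gamma> 1 x) \<and>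
      emeasure lborel B = ennreal (r * s ^ CARD('n) * (2 * 4 ^ (CARD('n) - 1))))"
proof -
  let ?n = "real CARD('n)"
  \<comment> \<open>The modulus lies between \<open>s / 2\<close> and \<open>(n + 3) * s\<close>,
    and \<open>Im (x$k)\<close> between \<open>r\<close> and \<open>2 * r\<close>; the minima cover
    both signs of \<open>\<gamma>\<close> and of \<open>\<beta>\<close>.\<close>
  define \<kappa> where "\<kappa> = min ((1/2) powr (-\<gamma>)) ((?n + 3) powr (-\<gamma>)) * min 1 (2 powr \<beta>)"
  have "\<kappa> > 0" by (simp add: \<kappa>_def)
  moreover have "\<exists>B\<in>sets lborel. B \<subseteq> {x::complex^'n. r < Im (x$k) \<and> Im (x$k) < 2 * r} \<and>
      (\<forall>x\<in>B. ennreal (\<kappa> * (s powr (-\<gamma>) * r powr \<beta>)) \<le> model k \<beta> \<gamma> 1 x) \<and>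
      emeasure lborel B = ennreal (r * s ^ CARD('n) * (2 * 4 ^ (CARD('n) - 1)))"
    if s: "1 \<le> s" and r: "0 < r" "r \<le> s" "s = 1 \<or> r = s" for s r
  proof -
    define l :: "complex^'n" where "l = (\<chi> i. if i = k then Complex (-s) r else Complex (- sqrt s) (- sqrt s))"
    define u :: "complex^'n" where "u = (\<chi> i. if i = k then Complex s (2*r) else Complex (sqrt s) (sqrt s))"
    have mem: "Re (l$i) < Re (x$i) \<and> Re (x$i) < Re (u$i) \<and> Im (l$i) < Im (x$i) \<and> Im (x$i) < Im (u$i)"
      if "x \<in> box l u" for x i
    proof -
      have "axis i 1 \<in> (Basis :: (complex^'n) set)" "axis i \<i> \<in> (Basis :: (complex^'n) set)"
        by (auto simp: axis_in_Basis_iff Basis_complex_def)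
      then have "l \<bullet> axis i 1 < x \<bullet> axis i 1 \<and> x \<bullet> axis i 1 < u \<bullet> axis i 1"
        "l \<bullet> axis i \<i> < x \<bullet> axis i \<i> \<and> x \<bullet> axis i \<i> < u \<bullet> axis i \<i>"
        using that unfolding mem_box by blast+
      then show ?thesis by (simp add: inner_axis)
    qed
    have "emeasure lborel (box l u) = ennreal (\<Prod>b\<in>Basis. (u - l) \<bullet> b)"
      using s r by (intro emeasure_lborel_box) (auto simp: Basis_vec_def Basis_complex_def inner_axis l_def u_def)
    also have "(\<Prod>b\<in>Basis. (u - l) \<bullet> b) = (\<Prod>i\<in>UNIV. (Re (u$i) - Re (l$i)) * (Im (u$i) - Im (l$i)))"
      by (subst prod_Basis_complex_vec) (simp add: inner_axis)
    also have "\<dots> = 2 * s * r * (\<Prod>i\<in>UNIV-{k}. (Re (u$i) - Re (l$i)) * (Im (u$i) - Im (l$i)))"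
      by (subst prod.remove[of _ k]) (auto simp: u_def l_def)
    also have "(\<Prod>i\<in>UNIV-{k}. (Re (u$i) - Re (l$i)) * (Im (u$i) - Im (l$i))) = (\<Prod>i\<in>UNIV-{k}. 4 * s)"
      using s by (intro prod.cong) (auto simp: u_def l_def)
    also have "2 * s * r * \<dots> = r * s ^ CARD('n) * (2 * 4 ^ (CARD('n) - 1))"
    proof -
      have "s * s ^ (CARD('n) - 1) = s ^ CARD('n)" by (metis power_eq_if zero_less_card_finite less_not_refl)
      then show ?thesis by (simp add: card_Diff_singleton power_mult_distrib)
    qed
    finally have em: "emeasure lborel (box l u) = ennreal (r * s ^ CARD('n) * (2 * 4 ^ (CARD('n) - 1)))" .
    have low: "ennreal (\<kappa> * (s powr (-\<gamma>) * r powr \<beta>)) \<le> model k \<beta> \<gamma> 1 x" if x: "x \<in> box l u" for x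
    proof -
      have k: "r < Im (x$k)" "Im (x$k) < 2 * r" "\<bar>Re (x$k)\<bar> \<le> s"
        using mem[OF x, of k] by (auto simp: l_def u_def)
      have "(cmod (x$j))\<^sup>2 \<le> 2 * s" if "j \<in> UNIV - {k}" for j
      proof -
        have "\<bar>Re (x$j)\<bar> \<le> sqrt s" "\<bar>Im (x$j)\<bar> \<le> sqrt s"
          using mem[OF x, of j] that by (auto simp: l_def u_def)
        then have "(Re (x$j))\<^sup>2 \<le> s" "(Im (x$j))\<^sup>2 \<le> s"
          using s by (metis abs_le_square_iff abs_of_nonneg real_sqrt_ge_zero real_sqrt_pow2 order_trans zero_le_one)+
        then show ?thesis unfolding cmod_power2 by simp
      qed
      then have "(\<Sum>j\<in>UNIV-{k}. (cmod (x$j))\<^sup>2) \<le> (\<Sum>j\<in>UNIV-{k}. 2 * s)" by (rule sum_mono)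
      also have "\<dots> \<le> 2 * ?n * s" using s by (simp add: card_Diff_singleton of_nat_diff algebra_simps)
      finally have S: "(\<Sum>j\<in>UNIV-{k}. (cmod (x$j))\<^sup>2) \<le> 2 * ?n * s" .
      \<comment> \<open>The alternative \<open>s = 1\<close> or \<open>r = s\<close> enters here:
        \<open>(1 + Im (x$k)) / 2\<close> reaches \<open>s / 2\<close> through the summand 1 in the
        first case and through \<open>Im (x$k) > r\<close> in the second.\<close>
      have ge: "s / 2 \<le> model_mod k 1 x"
        using model_mod_bounds(1)[of 1 x k] k r s by auto
      have "model_mod k 1 x \<le> 2 * ?n * s / 4 + (1 + Im (x$k)) / 2 + \<bar>Re (x$k)\<bar> / 2"
        using model_mod_bounds(3)[of 1 x k] k r S by linarith
      also have "\<dots> \<le> (?n + 3) * s"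
      proof -
        have "0 \<le> ?n * s" using s by simp
        then have "2 * ?n * s / 4 \<le> ?n * s" by linarith
        moreover have "(1 + Im (x$k)) / 2 + v / 2 \<le> 3 * s" if "v \<le> s" for v
          using that k(2) r(1,2) s by (simp add: field_simps)
        from this[OF k(3)] have "(1 + Im (x$k)) / 2 + \<bar>Re (x$k)\<bar> / 2 \<le> 3 * s" .
        ultimately have "2 * ?n * s / 4 + ((1 + Im (x$k)) / 2 + \<bar>Re (x$k)\<bar> / 2) \<le> ?n * s + 3 * s"
          by (rule add_mono)
        then show ?thesis unfolding distrib_right add.assoc .
      qed
      finally have le: "model_mod k 1 x \<le> (?n + 3) * s" .
      have mm: "min ((1/2) powr (-\<gamma>)) ((?n + 3) powr (-\<gamma>)) * s powr (-\<gamma>) \<le> model_mod k 1 x powr (-\<gamma>)"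
      proof (cases "\<gamma> \<ge> 0")
        case True
        have "((?n + 3) * s) powr (-\<gamma>) \<le> model_mod k 1 x powr (-\<gamma>)"
          using True le ge s by (intro powr_mono2') auto
        then have "(?n + 3) powr (-\<gamma>) * s powr (-\<gamma>) \<le> model_mod k 1 x powr (-\<gamma>)"
          using s by (simp add: powr_mult)
        then show ?thesis by (rule order_trans[rotated]) (intro mult_right_mono, auto)
      next
        case False
        have "((1/2) * s) powr (-\<gamma>) \<le> model_mod k 1 x powr (-\<gamma>)"
          using False ge s by (intro powr_mono2) auto
        then have "(1/2) powr (-\<gamma>) * s powr (-\<gamma>) \<le> model_mod k 1 x powr (-\<gamma>)"
          using s by (subst (asm) powr_mult) auto
        then show ?thesis by (rule order_trans[rotated]) (intro mult_right_mono, auto)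
      qed
      have rr: "min 1 (2 powr \<beta>) * r powr \<beta> \<le> Im (x$k) powr \<beta>"
      proof (cases "\<beta> \<ge> 0")
        case True
        have "r powr \<beta> \<le> Im (x$k) powr \<beta>" using True k r by (intro powr_mono2) auto
        moreover have "min 1 (2 powr \<beta>) * r powr \<beta> \<le> 1 * r powr \<beta>" by (intro mult_right_mono) auto
        ultimately show ?thesis by simp
      next
        case False
        have "(2 * r) powr \<beta> \<le> Im (x$k) powr \<beta>" using False k r by (intro powr_mono2') auto
        then have "2 powr \<beta> * r powr \<beta> \<le> Im (x$k) powr \<beta>" using r by (simp add: powr_mult)
        then show ?thesis by (rule order_trans[rotated]) (intro mult_right_mono, auto)
      qed
      have "\<kappa> * (s powr (-\<gamma>) * r powr \<beta>) = (min 1 (2 powr \<beta>) * r powr \<beta>)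
         * (min ((1/2) powr (-\<gamma>)) ((?n + 3) powr (-\<gamma>)) * s powr (-\<gamma>))"
        by (simp add: \<kappa>_def)
      also have "\<dots> \<le> Im (x$k) powr \<beta> * model_mod k 1 x powr (-\<gamma>)"
        by (intro mult_mono mm rr) auto
      finally show ?thesis using k r by (simp add: model_def ennreal_leI)
    qed
    have "box l u \<subseteq> {x. r < Im (x$k) \<and> Im (x$k) < 2 * r}"
      using mem[where i = k] by (auto simp: l_def u_def)
    then show ?thesis
      using em low by (intro bexI[of _ "box l u"]) auto
  qed
  ultimately show ?thesis by blast
qed

text \<open>If an inequality fails, dyadic boxes have masses bounded below: for
  \<open>s = 1\<close>, \<open>r = (1/2)^j\<close> the mass is of order
  \<open>r powr (\<beta> + 1)\<close>, for \<open>s = r = 2^j\<close> of order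
  \<open>s powr (n + 1 + \<beta> - \<gamma>)\<close>, and these powers are at least 1 when the
  respective inequality fails.\<close>

lemma nn_integral_model_finite_imp:
  fixes k :: "'n::finite"
  assumes fin: "(\<integral>\<^sup>+x. model k \<beta> \<gamma> 1 x \<partial>lborel) < \<infinity>"
  shows "\<beta> > -1" "\<gamma> > real CARD('n) + 1 + \<beta>"
proof -
  obtain \<kappa> where \<kappa>: "\<kappa> > 0" and box: "\<And>s r. 1 \<le> s \<Longrightarrow> 0 < r \<Longrightarrow> r \<le> s \<Longrightarrow> s = 1 \<or> r = s \<Longrightarrow>
    (\<exists>B\<in>sets lborel. B \<subseteq> {x::complex^'n. r < Im (x$k) \<and> Im (x$k) < 2 * r} \<and>
      (\<forall>x\<in>B. ennreal (\<kappa> * (s powr (-\<gamma>) * r powr \<beta>)) \<le> model k \<beta> \<gamma> 1 x) \<and>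
      emeasure lborel B = ennreal (r * s ^ CARD('n) * (2 * 4 ^ (CARD('n) - 1))))"
    using nn_integral_model_box_mass[of k \<gamma> \<beta>] by blast
  \<comment> \<open>One contradiction scheme for both inequalities: \<open>disj\<close> separates
    the slabs \<open>r < Im (x$k) < 2 * r\<close>, and \<open>big\<close> keeps the box masses from
    shrinking.\<close>
  have no: False if s: "\<And>j::nat. 1 \<le> s j \<and> 0 < r j \<and> r j \<le> s j \<and> (s j = 1 \<or> r j = s j)"
    and disj: "\<And>i j. i < j \<Longrightarrow> 2 * r i \<le> r j \<or> 2 * r j \<le> r i"
    and big: "\<And>j. 1 \<le> s j powr (-\<gamma>) * r j powr \<beta> * (r j * s j ^ CARD('n))" for s r
  proof -
    obtain B where B: "\<And>j. B j \<in> sets lborel" "\<And>j. B j \<subseteq> {x. r j < Im (x$k) \<and> Im (x$k) < 2 * r j}"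
      "\<And>j x. x \<in> B j \<Longrightarrow> ennreal (\<kappa> * (s j powr (-\<gamma>) * r j powr \<beta>)) \<le> model k \<beta> \<gamma> 1 x"
      "\<And>j. emeasure lborel (B j) = ennreal (r j * s j ^ CARD('n) * (2 * 4 ^ (CARD('n) - 1)))"
    proof -
      have "\<forall>j. \<exists>B. B \<in> sets lborel \<and> B \<subseteq> {x. r j < Im (x$k) \<and> Im (x$k) < 2 * r j} \<and>
        (\<forall>x\<in>B. ennreal (\<kappa> * (s j powr (-\<gamma>) * r j powr \<beta>)) \<le> model k \<beta> \<gamma> 1 x) \<and>
        emeasure lborel B = ennreal (r j * s j ^ CARD('n) * (2 * 4 ^ (CARD('n) - 1)))"
      proof
        fix j
        show "\<exists>B. B \<in> sets lborel \<and> B \<subseteq> {x. r j < Im (x$k) \<and> Im (x$k) < 2 * r j} \<and>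
        (\<forall>x\<in>B. ennreal (\<kappa> * (s j powr (-\<gamma>) * r j powr \<beta>)) \<le> model k \<beta> \<gamma> 1 x) \<and>
        emeasure lborel B = ennreal (r j * s j ^ CARD('n) * (2 * 4 ^ (CARD('n) - 1)))"
          using box[of "s j" "r j"] s[of j] by blast
      qed
      from choice[OF this] show ?thesis using that by blast
    qed
    have dj: "disjoint_family B"
      unfolding disjoint_family_on_def
    proof (intro ballI impI)
      fix i j :: nat assume "i \<noteq> j"
      then have "2 * r i \<le> r j \<or> 2 * r j \<le> r i" using disj[of i j] disj[of j i] by (cases "i < j") auto
      then show "B i \<inter> B j = {}" using B(2)[of i] B(2)[of j] by force
    qed
    have "(\<integral>\<^sup>+x. model k \<beta> \<gamma> 1 x \<partial>lborel) = \<infinity>"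
    proof (rule nn_integral_eq_top_if_uniform_mass[OF _ B(1) dj B(3)])
      fix j
      have "\<kappa> * (2 * 4 ^ (CARD('n) - 1)) * 1 \<le> \<kappa> * (2 * 4 ^ (CARD('n) - 1)) * (s j powr (-\<gamma>) * r j powr \<beta> * (r j * s j ^ CARD('n)))"
        using big[of j] \<kappa> by (intro mult_left_mono) auto
      then have "ennreal (\<kappa> * (2 * 4 ^ (CARD('n) - 1))) \<le>
         ennreal ((\<kappa> * (s j powr (-\<gamma>) * r j powr \<beta>)) * (r j * s j ^ CARD('n) * (2 * 4 ^ (CARD('n) - 1))))"
        by (intro ennreal_leI) (simp add: mult_ac)
      also have "\<dots> = ennreal (\<kappa> * (s j powr (-\<gamma>) * r j powr \<beta>)) * emeasure lborel (B j)"
        using \<kappa> by (subst ennreal_mult') (auto simp: B(4))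
      finally show "ennreal (\<kappa> * (2 * 4 ^ (CARD('n) - 1))) \<le> \<dots>" .
    qed (use \<kappa> in auto)
    then show False using fin by simp
  qed
  show "\<beta> > -1"
  proof (rule ccontr)
    assume b: "\<not> \<beta> > -1"
    show False
    proof (rule no[of "\<lambda>_. 1" "\<lambda>j. (1/2)^j"])
      fix i j :: nat assume "i < j"
      then have "(1/2::real)^j \<le> (1/2)^(Suc i)" by (intro power_decreasing) auto
      then show "2 * (1/2) ^ i \<le> (1/2::real) ^ j \<or> 2 * (1/2) ^ j \<le> (1/2::real) ^ i" by simp
    next
      fix j :: nat
      have "1 = ((1/2::real)^j) powr 0" by simp
      also have "\<dots> \<le> ((1/2::real)^j) powr (\<beta> + 1)"
        using b by (intro powr_mono') (auto simp: power_le_one)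
      finally show "1 \<le> 1 powr - \<gamma> * ((1 / 2) ^ j) powr \<beta> * ((1 / 2) ^ j * 1 ^ CARD('n))"
        by (simp add: powr_add)
    qed (auto simp: power_le_one)
  qed
  show "\<gamma> > real CARD('n) + 1 + \<beta>"
  proof (rule ccontr)
    assume g: "\<not> \<gamma> > real CARD('n) + 1 + \<beta>"
    show False
    proof (rule no[of "\<lambda>j. 2^j" "\<lambda>j. 2^j"])
      fix i j :: nat assume "i < j"
      then have "(2::real)^(Suc i) \<le> 2^j" by (intro power_increasing) auto
      then show "2 * 2 ^ i \<le> (2::real) ^ j \<or> 2 * 2 ^ j \<le> (2::real) ^ i" by simp
    next
      fix j :: nat
      have "1 = ((2::real)^j) powr 0" by simp
      also have "\<dots> \<le> ((2::real)^j) powr (-\<gamma> + \<beta> + (1 + real CARD('n)))"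
        using g by (intro powr_mono) auto
      also have "\<dots> = (2 ^ j) powr - \<gamma> * (2 ^ j) powr \<beta> * (2 ^ j * (2 ^ j) ^ CARD('n))"
        by (simp only: powr_add) (simp add: powr_realpow)
      finally show "1 \<le> (2 ^ j) powr - \<gamma> * (2 ^ j) powr \<beta> * (2 ^ j * (2 ^ j) ^ CARD('n))" .
    qed auto
  qed
qed

text \<open>Positivity allows this constant to be divided out when powers of \<open>rho k w\<close>
  are compared in the necessity part.\<close>

lemma nn_integral_model_pos:
  fixes k :: "'n::finite"
  shows "(\<integral>\<^sup>+x. model k \<beta> \<gamma> 1 x \<partial>lborel) > 0"
proof (rule ccontr)
  assume "\<not> ?thesis"
  then have "AE x in lborel. model k \<beta> \<gamma> 1 x = 0" by (simp add: nn_integral_0_iff_AE)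
  moreover have "open {x::complex^'n. 0 < Im (x$k)}"
    by (intro open_Collect_less continuous_intros)
  moreover have "(\<chi> i. \<i>) \<in> {x::complex^'n. 0 < Im (x$k)}" by simp
  ultimately obtain x :: "complex^'n" where "0 < Im (x$k)" "model k \<beta> \<gamma> 1 x = 0"
    using AE_lborel_open_ex by blast
  then show False using model_mod_bounds(1)[of 1 x k] by (auto simp: model_def)
qed

section \<open>Sufficiency\<close>

lemma ennpow_top [simp]: "ennpow top p = top"
  by (simp add: ennpow_def)

lemma ennpow_ennreal: "0 \<le> x \<Longrightarrow> ennpow (ennreal x) p = ennreal (x powr p)"
  by (simp add: ennpow_def)

lemma borel_measurable_ennpow [measurable]:
  assumes [measurable]: "f \<in> borel_measurable M"
  shows "(\<lambda>x. ennpow (f x) p) \<in> borel_measurable M"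
  unfolding ennpow_def by measurable

text \<open>Young's inequality for the two functions divided by their norms; zero norms are treated
  apart because of this division. \<open>F\<close> is extended valued since it will be an inner
  integral that may be infinite at some points.\<close>

lemma nn_integral_Holder_ennpow:
  fixes h :: "'a \<Rightarrow> real"
  assumes [measurable]: "F \<in> borel_measurable M" "h \<in> borel_measurable M"
    and h: "\<And>x. 0 \<le> h x" and pq: "p > 1" "q > 1" "1/p + 1/q = 1"
    and A: "(\<integral>\<^sup>+x. ennpow (F x) p \<partial>M) = ennreal A" "0 \<le> A"
    and B: "(\<integral>\<^sup>+x. ennreal (h x powr q) \<partial>M) = ennreal B" "0 \<le> B"
  shows "(\<integral>\<^sup>+x. F x * ennreal (h x) \<partial>M) \<le> ennreal (A powr (1/p) * B powr (1/q))"
proof -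
  consider "A = 0" | "B = 0" | "A > 0" "B > 0" using A(2) B(2) by linarith
  then show ?thesis
  proof cases
    case 1
    then have "AE x in M. ennpow (F x) p = 0" using A by (simp add: nn_integral_0_iff_AE)
    then have "AE x in M. F x * ennreal (h x) = 0"
    proof eventually_elim
      case (elim x)
      then show ?case by (cases "F x") (auto simp: ennpow_ennreal)
    qed
    then have "(\<integral>\<^sup>+x. F x * ennreal (h x) \<partial>M) = 0" by (subst nn_integral_0_iff_AE) auto
    then show ?thesis by simp
  next
    case 2
    then have "AE x in M. ennreal (h x powr q) = 0" using B by (simp add: nn_integral_0_iff_AE)
    then have "AE x in M. F x * ennreal (h x) = 0"
      by eventually_elim (auto simp: powr_def split: if_splits)
    then have "(\<integral>\<^sup>+x. F x * ennreal (h x) \<partial>M) = 0" by (subst nn_integral_0_iff_AE) auto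
    then show ?thesis by simp
  next
    case 3
    \<comment> \<open>The target bound itself: the weights \<open>D / (p * A)\<close> and
      \<open>D / (q * B)\<close> below integrate to \<open>D * (1/p + 1/q) = D\<close>.\<close>
    define D where "D = A powr (1/p) * B powr (1/q)"
    have D: "D > 0" using 3 by (simp add: D_def)
    have pt: "F x * ennreal (h x) \<le> ennreal (D / (p * A)) * ennpow (F x) p + ennreal (D / (q * B)) * ennreal (h x powr q)" for x
    proof (cases "F x")
      case top
      then show ?thesis using D 3 pq by (simp add: ennreal_mult_top)
    next
      case (real f)
      have "(f / A powr (1/p)) * (h x / B powr (1/q)) \<le> (f / A powr (1/p)) powr p / p + (h x / B powr (1/q)) powr q / q"
        using real h pq 3 by (intro Youngs_inequality) auto
      also have "(f / A powr (1/p)) powr p = f powr p / A"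
        using real pq 3 by (subst powr_divide) (auto simp: powr_powr)
      also have "(h x / B powr (1/q)) powr q = h x powr q / B"
        using h pq 3 by (subst powr_divide) (auto simp: powr_powr)
      finally have "D * ((f / A powr (1/p)) * (h x / B powr (1/q))) \<le> D * (f powr p / A / p + h x powr q / B / q)"
        using D by (intro mult_left_mono) auto
      moreover have "D * ((f / A powr (1/p)) * (h x / B powr (1/q))) = f * h x"
        using 3 by (simp add: D_def)
      ultimately have "f * h x \<le> D / (p * A) * f powr p + D / (q * B) * h x powr q"
        by (simp add: distrib_left mult_ac)
      then have "ennreal (f * h x) \<le> ennreal (D / (p * A) * f powr p + D / (q * B) * h x powr q)"
        by (rule ennreal_leI)
      also have "\<dots> = ennreal (D / (p * A)) * ennreal (f powr p) + ennreal (D / (q * B)) * ennreal (h x powr q)"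
        using D pq 3 by (subst ennreal_plus) (auto simp del: times_divide_eq_left simp: ennreal_mult'')
      finally show ?thesis using real h by (simp add: ennpow_ennreal ennreal_mult')
    qed
    have "(\<integral>\<^sup>+x. F x * ennreal (h x) \<partial>M)
      \<le> (\<integral>\<^sup>+x. ennreal (D / (p * A)) * ennpow (F x) p + ennreal (D / (q * B)) * ennreal (h x powr q) \<partial>M)"
      by (intro nn_integral_mono pt)
    also have "\<dots> = ennreal (D / (p * A)) * ennreal A + ennreal (D / (q * B)) * ennreal B"
      by (subst nn_integral_add) (auto simp: nn_integral_cmult A B)
    also have "\<dots> = ennreal (D / (p * A) * A + D / (q * B) * B)"
      using D pq 3 by (simp add: ennreal_mult''[symmetric] ennreal_plus[symmetric] del: ennreal_plus)
    also have "D / (p * A) * A + D / (q * B) * B = D * (1/p + 1/q)"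
      using 3 by (simp add: field_simps)
    also have "\<dots> = D" using pq by simp
    finally show ?thesis by (simp add: D_def)
  qed
qed

text \<open>The modulus of one factor of either kernel: for a real exponent,
  \<open>cmod (\<zeta> powr c)\<close> is \<open>cmod \<zeta> powr c\<close>, so the branch of the
  power disappears.\<close>

definition kernel_abs :: "'n::finite \<Rightarrow> real \<Rightarrow> real \<Rightarrow> complex^'n \<Rightarrow> complex^'n \<Rightarrow> real" where
  "kernel_abs k b c z u = rho k u powr b * cmod (rho2 k z u) powr (-c)"

lemma kernel_abs_nonneg [simp]: "0 \<le> kernel_abs k b c z u"
  by (simp add: kernel_abs_def)

lemma kernel_abs_pos: "z \<in> TB k \<Longrightarrow> u \<in> TB k \<Longrightarrow> 0 < kernel_abs k b c z u"
  using rho_pos[of u k] rho2_nonzero[of z k u] by (simp add: kernel_abs_def)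

lemma borel_measurable_kernel_abs [measurable]:
  assumes [measurable]: "f \<in> borel_measurable M"
  shows "(\<lambda>x. kernel_abs k b c z (f x)) \<in> borel_measurable M"
  unfolding kernel_abs_def by measurable

lemma continuous_on_kernel_abs:
  "z \<in> TB k \<Longrightarrow> continuous_on (TB k) (kernel_abs k b c z)"
  unfolding kernel_abs_def
  by (intro continuous_intros) (auto dest: rho_pos rho2_nonzero simp: less_imp_neq[symmetric])

text \<open>Only the modulus of the kernel and its continuity matter, so that \<open>S\<close> and \<open>T\<close> can be
  treated simultaneously.\<close>

locale siegel_kernel =
  fixes k :: "'n::finite" and b c :: "real \<times> real"
    and K :: "complex^'n \<Rightarrow> complex^'n \<Rightarrow> complex^'n \<Rightarrow> complex^'n \<Rightarrow> complex"
  assumes cmod_K: "\<And>z w u \<eta>. z \<in> TB k \<Longrightarrow> w \<in> TB k \<Longrightarrow> u \<in> TB k \<Longrightarrow> \<eta> \<in> TB k \<Longrightarrow>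
      cmod (K z w u \<eta>) = kernel_abs k (fst b) (fst c) z u * kernel_abs k (snd b) (snd c) w \<eta>"
    and continuous_on_K: "continuous_on ((TB k \<times> TB k) \<times> (TB k \<times> TB k))
      (\<lambda>x. K (fst (fst x)) (snd (fst x)) (fst (snd x)) (snd (snd x)))"

lemma siegel_kernel_kerS: "siegel_kernel k b c (kerS k b c)"
proof
  show "cmod (kerS k b c z w u \<eta>) = kernel_abs k (fst b) (fst c) z u * kernel_abs k (snd b) (snd c) w \<eta>" for z w u \<eta>
    by (simp add: kerS_def kernel_abs_def powr_minus divide_inverse norm_mult norm_inverse)
  have "rho2 k u v \<noteq> 0" "rho k u \<noteq> 0" if "u \<in> TB k" "v \<in> TB k" for u v
    using that rho2_nonzero rho_pos by force+
  then show "continuous_on ((TB k \<times> TB k) \<times> TB k \<times> TB k)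
     (\<lambda>x. kerS k b c (fst (fst x)) (snd (fst x)) (fst (snd x)) (snd (snd x)))"
    unfolding kerS_def
    by (intro continuous_intros) auto
qed

text \<open>Since \<open>Re (rho2 k z u) > 0\<close>, the bases stay off the branch cut and the
  principal powers are continuous; the exponents being real, the modulus does not see the argument
  of the base.\<close>

lemma siegel_kernel_kerT: "siegel_kernel k b c (kerT k b c)"
proof
  show "cmod (kerT k b c z w u \<eta>) = kernel_abs k (fst b) (fst c) z u * kernel_abs k (snd b) (snd c) w \<eta>" for z w u \<eta>
    by (simp add: kerT_def kernel_abs_def powr_minus divide_inverse norm_mult norm_inverse norm_powr_real_powr')
  have "rho2 k u v \<noteq> 0" "rho k u \<noteq> 0" "Re (rho2 k u v) \<ge> 0" if "u \<in> TB k" "v \<in> TB k" for u v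
    using that rho2_nonzero rho_pos Re_rho2_pos[of u k v] by force+
  then show "continuous_on ((TB k \<times> TB k) \<times> TB k \<times> TB k)
     (\<lambda>x. kerT k b c (fst (fst x)) (snd (fst x)) (fst (snd x)) (snd (snd x)))"
    unfolding kerT_def
    by (intro continuous_intros) auto
qed

lemma nn_integral_kernel:
  fixes k :: "'n::finite"
  assumes "w \<in> TB k"
  shows "(\<integral>\<^sup>+\<eta>\<in>TB k. ennreal (rho k \<eta> powr \<beta> * cmod (rho2 k w \<eta>) powr (-\<gamma>)) \<partial>lborel)
    = ennreal (rho k w powr (real CARD('n) + 1 + \<beta> - \<gamma>)) * (\<integral>\<^sup>+x. model k \<beta> \<gamma> 1 x \<partial>lborel)"
  unfolding nn_integral_kernel_eq_model by (rule nn_integral_model_scale[OF rho_pos[OF assms]])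

text \<open>For the measure with density \<open>rho k \<eta> powr \<alpha>\<close> the dual norm is
  that of the kernel divided by the density, which lowers \<open>b\<close> to
  \<open>b - \<alpha>\<close>. Its \<open>q\<close>-th power times the density is the model
  integrand with \<open>\<beta> = (b - \<alpha>) * q + \<alpha>\<close> and
  \<open>\<gamma> = c * q\<close>.\<close>

lemma kernel_abs_powr:
  assumes "\<eta> \<in> TB k" "w \<in> TB k"
  shows "kernel_abs k (b - \<alpha>) c w \<eta> powr q * rho k \<eta> powr \<alpha>
    = rho k \<eta> powr ((b - \<alpha>) * q + \<alpha>) * cmod (rho2 k w \<eta>) powr (- (c * q))"
  using rho_pos[OF assms(1)] rho2_nonzero[OF assms(2,1)]
  by (simp add: kernel_abs_def powr_mult powr_powr powr_add)

text \<open>With \<open>m = cmod (rho2 k z u)\<close>, both \<open>rho k z\<close> and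
  \<open>rho k u\<close> are at most \<open>2 * m\<close>. As \<open>a\<close> and
  \<open>b - \<alpha>\<close> are nonnegative, both powers may be replaced by powers of
  \<open>2 * m\<close>, and the powers of \<open>m\<close> cancel exactly.\<close>

lemma rho_powr_kernel_abs_le:
  assumes "z \<in> TB k" "u \<in> TB k" "a \<ge> 0" "b \<ge> \<alpha>"
  shows "rho k z powr a * kernel_abs k b (a + b - \<alpha>) z u \<le> 2 powr (a + b - \<alpha>) * rho k u powr \<alpha>"
proof -
  define m where "m = cmod (rho2 k z u)"
  have m: "m > 0" using rho2_nonzero[OF assms(1,2)] by (simp add: m_def)
  have z: "rho k z > 0" "rho k u > 0" using assms rho_pos by auto
  have "rho k z powr a * rho k u powr (b - \<alpha>) \<le> (2 * m) powr a * (2 * m) powr (b - \<alpha>)"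
    using cmod_rho2_ge[OF assms(1,2)] assms z by (intro mult_mono powr_mono2) (auto simp: m_def)
  also have "\<dots> = (2 * m) powr (a + b - \<alpha>)" using m by (simp add: powr_add[symmetric] algebra_simps)
  also have "\<dots> = 2 powr (a + b - \<alpha>) * m powr (a + b - \<alpha>)" using m by (simp add: powr_mult)
  finally have le: "rho k z powr a * rho k u powr (b - \<alpha>) * (m powr (- (a + b - \<alpha>)) * rho k u powr \<alpha>)
     \<le> 2 powr (a + b - \<alpha>) * m powr (a + b - \<alpha>) * (m powr (- (a + b - \<alpha>)) * rho k u powr \<alpha>)"
    by (intro mult_right_mono) auto
  have "m powr (a + b - \<alpha>) * m powr (- (a + b - \<alpha>)) = 1"
    using m by (subst powr_add[symmetric]) simp
  then have e1: "2 powr (a + b - \<alpha>) * m powr (a + b - \<alpha>) * (m powr (- (a + b - \<alpha>)) * rho k u powr \<alpha>)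
     = 2 powr (a + b - \<alpha>) * rho k u powr \<alpha>"
    by (simp only: mult.assoc[symmetric]) (simp only: mult.assoc mult_1_right)
  have "rho k u powr b = rho k u powr (b - \<alpha>) * rho k u powr \<alpha>" by (simp add: powr_add[symmetric])
  then have e2: "rho k z powr a * kernel_abs k b (a + b - \<alpha>) z u
     = rho k z powr a * rho k u powr (b - \<alpha>) * (m powr (- (a + b - \<alpha>)) * rho k u powr \<alpha>)"
    unfolding kernel_abs_def m_def[symmetric] by (simp only: mult_ac)
  show ?thesis using le unfolding e1 e2 .
qed

section \<open>Boundedness from the exponent conditions\<close>

context siegel_kernel
begin

lemma measurable_K_mult:
  assumes [measurable]: "f \<in> borel_measurable borel" and zw: "z \<in> TB k" "w \<in> TB k"
  shows "(\<lambda>y. indicator (TB k \<times> TB k) y *\<^sub>R (K z w (fst y) (snd y) * f y)) \<in> borel_measurable borel"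
proof -
  have "continuous_on (TB k \<times> TB k) ((\<lambda>x. K (fst (fst x)) (snd (fst x)) (fst (snd x)) (snd (snd x))) \<circ> (\<lambda>y. ((z, w), y)))"
    using zw by (intro continuous_on_compose continuous_on_subset[OF continuous_on_K]) (auto intro!: continuous_intros)
  then have "continuous_on (TB k \<times> TB k) (\<lambda>y. K z w (fst y) (snd y))" by (simp add: o_def)
  then have "(\<lambda>y. indicator (TB k \<times> TB k) y *\<^sub>R K z w (fst y) (snd y)) \<in> borel_measurable borel"
    by (intro borel_measurable_continuous_on_indicator) (auto intro!: borel_open open_Times open_TB)
  then have "(\<lambda>y. (indicator (TB k \<times> TB k) y *\<^sub>R K z w (fst y) (snd y)) * f y) \<in> borel_measurable borel"
    by measurable
  then show ?thesis by simp
qed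

lemma nn_integral_K:
  assumes [measurable]: "f \<in> borel_measurable borel" and zw: "z \<in> TB k" "w \<in> TB k"
  shows "(\<integral>\<^sup>+y. ennreal (norm (indicator (TB k \<times> TB k) y *\<^sub>R (K z w (fst y) (snd y) * f y))) \<partial>lborel)
    = (\<integral>\<^sup>+\<eta>\<in>TB k. (\<integral>\<^sup>+u\<in>TB k. ennreal (kernel_abs k (fst b) (fst c) z u * cmod (f (u, \<eta>))) \<partial>lborel)
        * ennreal (kernel_abs k (snd b) (snd c) w \<eta>) \<partial>lborel)"
proof -
  define g where "g u \<eta> = ennreal (kernel_abs k (fst b) (fst c) z u * cmod (f (u, \<eta>))) * indicator (TB k) u
       * (ennreal (kernel_abs k (snd b) (snd c) w \<eta>) * indicator (TB k) \<eta>)" for u \<eta>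
  have [measurable]: "f \<in> borel_measurable (borel \<Otimes>\<^sub>M borel)" by (simp add: borel_prod)
  have [measurable]: "case_prod g \<in> borel_measurable (lborel \<Otimes>\<^sub>M lborel)"
    unfolding g_def by measurable
  have "(\<integral>\<^sup>+y. ennreal (norm (indicator (TB k \<times> TB k) y *\<^sub>R (K z w (fst y) (snd y) * f y))) \<partial>lborel)
     = (\<integral>\<^sup>+y. case_prod g y \<partial>lborel)"
  proof (rule nn_integral_cong)
    fix y :: "(complex^'n) \<times> (complex^'n)"
    obtain u \<eta> where y: "y = (u, \<eta>)" by (cases y)
    show "ennreal (norm (indicator (TB k \<times> TB k) y *\<^sub>R (K z w (fst y) (snd y) * f y))) = case_prod g y"
    proof (cases "u \<in> TB k \<and> \<eta> \<in> TB k")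
      case True
      then have "cmod (K z w u \<eta> * f (u, \<eta>)) = (kernel_abs k (fst b) (fst c) z u * cmod (f (u, \<eta>)))
          * kernel_abs k (snd b) (snd c) w \<eta>"
        using zw by (simp add: norm_mult cmod_K)
      with True show ?thesis unfolding y g_def by (simp add: ennreal_mult'')
    qed (auto simp: y g_def)
  qed
  also have "\<dots> = (\<integral>\<^sup>+\<eta>. (\<integral>\<^sup>+u. g u \<eta> \<partial>lborel) \<partial>lborel)"
    using lborel_pair.nn_integral_snd[of "case_prod g", OF \<open>case_prod g \<in> _\<close>]
    by (simp add: lborel_prod)
  also have "\<dots> = (\<integral>\<^sup>+\<eta>\<in>TB k. (\<integral>\<^sup>+u\<in>TB k. ennreal (kernel_abs k (fst b) (fst c) z u * cmod (f (u, \<eta>))) \<partial>lborel)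
        * ennreal (kernel_abs k (snd b) (snd c) w \<eta>) \<partial>lborel)"
    unfolding g_def by (subst nn_integral_multc) (auto simp: mult.assoc)
  finally show ?thesis .
qed

text \<open>The supremum estimate in \<open>u\<close> leaves the inner weighted norm
  \<open>F \<eta>\<close>, and Hoelder in \<open>\<eta>\<close> pairs it with the
  \<open>q\<close>-norm of the kernel. The powers of \<open>rho k z\<close> and
  \<open>rho k w\<close> so produced cancel the outer weights, at every point of the domain.\<close>

lemma bounded_if:
  assumes p: "1 < p"
    and a: "fst a \<ge> 0" "snd a > 0" and b: "fst b \<ge> fst \<alpha>" "p * (snd b + 1) > snd \<alpha> + 1"
    and c: "fst c = fst a + fst b - fst \<alpha>"
      "snd c = real CARD('n) + 1 + snd a + snd b - (real CARD('n) + 1 + snd \<alpha>) / p"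
  shows "bounded_1p_to_Linf k p \<alpha> a K"
proof -
  define q where "q = p / (p - 1)"
  have q: "q > 1" "1/p + 1/q = 1" "q / p = q - 1" using p by (auto simp: q_def field_simps)
  define \<beta> where "\<beta> = (snd b - snd \<alpha>) * q + snd \<alpha>"
  define \<gamma> where "\<gamma> = snd c * q"
  \<comment> \<open>The prescribed \<open>snd c\<close> makes the scaling exponent equal to
    \<open>- (snd a * q)\<close>; after the \<open>q\<close>-th root this cancels
    \<open>rho k w powr snd a\<close>.\<close>
  have \<gamma>: "real CARD('n) + 1 + \<beta> - \<gamma> = - (snd a * q)"
  proof -
    have "(real CARD('n) + 1 + snd \<alpha>) / p * q = (real CARD('n) + 1 + snd \<alpha>) * (q - 1)"
      using q(3) by (metis times_divide_eq_left times_divide_eq_right)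
    then show ?thesis unfolding \<beta>_def \<gamma>_def c(2) left_diff_distrib by (simp add: algebra_simps)
  qed
  \<comment> \<open>\<open>(\<beta> + 1) * (p - 1) = p * (snd b + 1) - (snd \<alpha> + 1)\<close>,
    so this is the hypothesis on \<open>snd b\<close> in another form.\<close>
  have \<beta>: "\<beta> > -1"
  proof -
    have "0 < (p * (snd b + 1) - (snd \<alpha> + 1)) / (p - 1)" using b(2) p by simp
    also have "\<dots> = \<beta> + 1" using p by (simp add: \<beta>_def q_def field_simps)
    finally show ?thesis by simp
  qed
  have "(\<integral>\<^sup>+x. model k \<beta> \<gamma> 1 x \<partial>lborel) < \<infinity>"
    using \<gamma> a q by (intro nn_integral_model_finite \<beta>) (smt (verit) mult_pos_pos)
  then obtain J where J: "(\<integral>\<^sup>+x. model k \<beta> \<gamma> 1 x \<partial>lborel) = ennreal J" "0 \<le> J"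
    by (cases "\<integral>\<^sup>+x. model k \<beta> \<gamma> 1 x \<partial>lborel") auto
  define C where "C = 2 powr fst c * J powr (1/q)"
  have main: "set_integrable lborel (TB k \<times> TB k) (\<lambda>y. K z w (fst y) (snd y) * f y)
      \<and> cmod (int_op k a K f z w) \<le> C * enn2real (mixed_norm_1p k p \<alpha> f)"
    if f: "f \<in> borel_measurable borel" and fin: "mixed_norm_1p k p \<alpha> f < \<infinity>"
      and z: "z \<in> TB k" and w: "w \<in> TB k" for f z w
  proof -
    note [measurable] = f
    have [measurable]: "f \<in> borel_measurable (borel \<Otimes>\<^sub>M borel)" by (simp add: borel_prod)
    define F where "F \<eta> = (\<integral>\<^sup>+u\<in>TB k. ennreal (cmod (f (u, \<eta>)) * rho k u powr fst \<alpha>) \<partial>lborel)" for \<eta>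
    have [measurable]: "F \<in> borel_measurable borel"
      unfolding F_def by measurable
    \<comment> \<open>The weight goes into the measure, so that Hoelder applies unweighted and the
      mixed norm becomes the \<open>p\<close>-norm of \<open>F\<close> over
      \<open>M\<close>.\<close>
    define M where "M = density lborel (\<lambda>\<eta>. ennreal (rho k \<eta> powr snd \<alpha>) * indicator (TB k) \<eta>)"
    have [measurable_cong, simp]: "sets M = sets borel" by (simp add: M_def)
    have NM: "(\<integral>\<^sup>+\<eta>. g \<eta> \<partial>M) = (\<integral>\<^sup>+\<eta>\<in>TB k. g \<eta> * ennreal (rho k \<eta> powr snd \<alpha>) \<partial>lborel)"
      if [measurable]: "g \<in> borel_measurable borel" for g
      unfolding M_def by (subst nn_integral_density) (auto simp: mult_ac)
    have mn: "mixed_norm_1p k p \<alpha> f = ennpow (\<integral>\<^sup>+\<eta>. ennpow (F \<eta>) p \<partial>M) (1/p)"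
      by (subst NM) (auto simp: mixed_norm_1p_def F_def)
    then have "(\<integral>\<^sup>+\<eta>. ennpow (F \<eta>) p \<partial>M) \<noteq> top" using fin by auto
    then obtain A where A: "(\<integral>\<^sup>+\<eta>. ennpow (F \<eta>) p \<partial>M) = ennreal A" "0 \<le> A"
      by (cases "\<integral>\<^sup>+\<eta>. ennpow (F \<eta>) p \<partial>M") auto
    define h where "h = kernel_abs k (snd b - snd \<alpha>) (snd c) w"
    have [measurable]: "h \<in> borel_measurable borel" unfolding h_def by measurable
    define B where "B = rho k w powr (- (snd a * q)) * J"
    have "(\<integral>\<^sup>+\<eta>. ennreal (h \<eta> powr q) \<partial>M)
        = (\<integral>\<^sup>+\<eta>\<in>TB k. ennreal (rho k \<eta> powr \<beta> * cmod (rho2 k w \<eta>) powr (-\<gamma>)) \<partial>lborel)"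
      by (subst NM) (auto intro!: nn_integral_cong split: split_indicator
          simp: h_def ennreal_mult'[symmetric] kernel_abs_powr[OF _ w] \<beta>_def \<gamma>_def)
    also have "\<dots> = ennreal B"
      unfolding nn_integral_kernel[OF w] \<gamma> J(1) B_def using J(2) by (simp add: ennreal_mult'')
    finally have B: "(\<integral>\<^sup>+\<eta>. ennreal (h \<eta> powr q) \<partial>M) = ennreal B" "0 \<le> B"
      using J by (auto simp: B_def)
    have Bq: "B powr (1/q) = rho k w powr (- snd a) * J powr (1/q)"
      using J q by (simp add: B_def powr_mult powr_powr)
    have inner: "(\<integral>\<^sup>+u\<in>TB k. ennreal (kernel_abs k (fst b) (fst c) z u * cmod (f (u, \<eta>))) \<partial>lborel)
        \<le> ennreal (2 powr fst c * rho k z powr (- fst a)) * F \<eta>" for \<eta>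
    proof -
      have le: "kernel_abs k (fst b) (fst c) z u \<le> 2 powr fst c * rho k z powr (- fst a) * rho k u powr fst \<alpha>"
        if "u \<in> TB k" for u
      proof -
        have le: "rho k z powr (- fst a) * (rho k z powr fst a * kernel_abs k (fst b) (fst c) z u)
           \<le> rho k z powr (- fst a) * (2 powr fst c * rho k u powr fst \<alpha>)"
          using rho_powr_kernel_abs_le[OF z that a(1) b(1)] unfolding c(1) by (intro mult_left_mono) auto
        have "rho k z powr (- fst a) * rho k z powr fst a = 1"
          using rho_pos[OF z] by (simp add: powr_add[symmetric])
        then have e: "rho k z powr (- fst a) * (rho k z powr fst a * kernel_abs k (fst b) (fst c) z u)
           = kernel_abs k (fst b) (fst c) z u" by (metis mult.assoc mult_1)
        show ?thesis using le unfolding e by (simp only: mult_ac)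
      qed
      have "(\<integral>\<^sup>+u\<in>TB k. ennreal (kernel_abs k (fst b) (fst c) z u * cmod (f (u, \<eta>))) \<partial>lborel)
         \<le> (\<integral>\<^sup>+u. ennreal (2 powr fst c * rho k z powr (- fst a)) *
             (ennreal (cmod (f (u, \<eta>)) * rho k u powr fst \<alpha>) * indicator (TB k) u) \<partial>lborel)"
      proof (rule nn_integral_mono)
        fix u :: "complex^'n"
        have "kernel_abs k (fst b) (fst c) z u * cmod (f (u, \<eta>))
          \<le> (2 powr fst c * rho k z powr (- fst a)) * (cmod (f (u, \<eta>)) * rho k u powr fst \<alpha>)" if "u \<in> TB k"
          using mult_right_mono[OF le[OF that], of "cmod (f (u, \<eta>))"] by (simp add: mult_ac)
        then show "ennreal (kernel_abs k (fst b) (fst c) z u * cmod (f (u, \<eta>))) * indicator (TB k) u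
           \<le> ennreal (2 powr fst c * rho k z powr (- fst a)) *
             (ennreal (cmod (f (u, \<eta>)) * rho k u powr fst \<alpha>) * indicator (TB k) u)"
          by (auto simp: ennreal_mult'[symmetric] ennreal_leI split: split_indicator)
      qed
      also have "\<dots> = ennreal (2 powr fst c * rho k z powr (- fst a)) * F \<eta>"
        unfolding F_def by (subst nn_integral_cmult) auto
      finally show ?thesis .
    qed
    let ?I = "\<integral>\<^sup>+y. ennreal (norm (indicator (TB k \<times> TB k) y *\<^sub>R (K z w (fst y) (snd y) * f y))) \<partial>lborel"
    have "?I \<le> (\<integral>\<^sup>+\<eta>. ennreal (2 powr fst c * rho k z powr (- fst a)) * (F \<eta> * ennreal (h \<eta>) *
         ennreal (rho k \<eta> powr snd \<alpha>) * indicator (TB k) \<eta>) \<partial>lborel)"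
      unfolding nn_integral_K[OF f z w]
    proof (rule nn_integral_mono)
      fix \<eta> :: "complex^'n"
      have "kernel_abs k (snd b) (snd c) w \<eta> = h \<eta> * rho k \<eta> powr snd \<alpha>"
        by (simp add: h_def kernel_abs_def powr_add[symmetric])
      then have "(\<integral>\<^sup>+u\<in>TB k. ennreal (kernel_abs k (fst b) (fst c) z u * cmod (f (u, \<eta>))) \<partial>lborel)
          * ennreal (kernel_abs k (snd b) (snd c) w \<eta>) * indicator (TB k) \<eta>
        \<le> ennreal (2 powr fst c * rho k z powr (- fst a)) * F \<eta> * ennreal (h \<eta> * rho k \<eta> powr snd \<alpha>) * indicator (TB k) \<eta>"
        by (auto intro!: mult_right_mono inner)
      then show "(\<integral>\<^sup>+u\<in>TB k. ennreal (kernel_abs k (fst b) (fst c) z u * cmod (f (u, \<eta>))) \<partial>lborel)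
          * ennreal (kernel_abs k (snd b) (snd c) w \<eta>) * indicator (TB k) \<eta>
        \<le> ennreal (2 powr fst c * rho k z powr (- fst a)) * (F \<eta> * ennreal (h \<eta>) *
         ennreal (rho k \<eta> powr snd \<alpha>) * indicator (TB k) \<eta>)"
        by (simp add: ennreal_mult'' mult.assoc)
    qed
    also have "\<dots> = ennreal (2 powr fst c * rho k z powr (- fst a)) * (\<integral>\<^sup>+\<eta>. F \<eta> * ennreal (h \<eta>) \<partial>M)"
      by (subst nn_integral_cmult) (auto simp: NM)
    also have "\<dots> \<le> ennreal (2 powr fst c * rho k z powr (- fst a)) * ennreal (A powr (1/p) * B powr (1/q))"
      by (intro mult_left_mono nn_integral_Holder_ennpow[OF _ _ _ p q(1,2) A B]) (auto simp: h_def)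
    also have "\<dots> = ennreal ((2 powr fst c * rho k z powr (- fst a)) * (A powr (1/p) * B powr (1/q)))"
      by (simp add: ennreal_mult'')
    finally have I: "?I \<le> \<dots>" .
    have int: "set_integrable lborel (TB k \<times> TB k) (\<lambda>y. K z w (fst y) (snd y) * f y)"
      unfolding set_integrable_def
      by (rule integrableI_bounded) (use measurable_K_mult[OF f z w] I in \<open>auto intro: le_less_trans\<close>)
    then have "ennreal (norm (set_lebesgue_integral lborel (TB k \<times> TB k) (\<lambda>y. K z w (fst y) (snd y) * f y))) \<le> ?I"
      unfolding set_lebesgue_integral_def set_integrable_def by (rule integral_norm_bound_ennreal)
    also note I
    finally have nb: "norm (set_lebesgue_integral lborel (TB k \<times> TB k) (\<lambda>y. K z w (fst y) (snd y) * f y))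
      \<le> (2 powr fst c * rho k z powr (- fst a)) * (A powr (1/p) * B powr (1/q))"
      by simp
    have "cmod (int_op k a K f z w) \<le> (rho k z powr fst a * rho k w powr snd a) *
        ((2 powr fst c * rho k z powr (- fst a)) * (A powr (1/p) * (rho k w powr (- snd a) * J powr (1/q))))"
      unfolding int_op_def norm_mult using nb unfolding Bq by (intro mult_mono) (auto simp: norm_mult)
    also have "\<dots> = C * A powr (1/p)"
      using rho_pos[OF z] rho_pos[OF w] by (simp add: C_def powr_minus field_simps)
    also have "A powr (1/p) = enn2real (mixed_norm_1p k p \<alpha> f)"
      by (simp add: mn A ennpow_ennreal)
    finally show ?thesis using int by blast
  qed
  show ?thesis
    unfolding bounded_1p_to_Linf_def
    by (intro exI[of _ C] allI impI AE_I2) (use main in \<open>auto simp: mem_Times_iff\<close>)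
qed

end

section \<open>Necessity\<close>

lemma nn_integral_compact_support_finite:
  fixes h :: "'a::euclidean_space \<Rightarrow> real"
  assumes Q: "compact Q" and "\<And>x. x \<in> Q \<Longrightarrow> h x \<le> B" and "\<And>x. x \<notin> Q \<Longrightarrow> h x = 0"
  shows "(\<integral>\<^sup>+x. ennreal (h x) \<partial>lborel) < \<infinity>"
proof -
  have "(\<integral>\<^sup>+x. ennreal (h x) \<partial>lborel) \<le> (\<integral>\<^sup>+x. ennreal B * indicator Q x \<partial>lborel)"
    using assms by (intro nn_integral_mono) (auto intro!: ennreal_leI split: split_indicator)
  also have "\<dots> = ennreal B * emeasure lborel Q"
    using Q by (intro nn_integral_cmult_indicator) (auto intro: borel_compact)
  also have "\<dots> < \<infinity>" using emeasure_compact_finite[OF Q] by (simp add: ennreal_mult_less_top)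
  finally show ?thesis .
qed

text \<open>Multiplying \<open>g\<close> by this factor yields \<open>cmod (g x)\<close>; at zeros
  of \<open>g\<close> the quotient is 0 by the convention on division, so measurability requires no
  case distinction.\<close>

lemma borel_measurable_phase:
  assumes "g \<in> borel_measurable M"
  shows "(\<lambda>x. cnj (g x) / complex_of_real (cmod (g x))) \<in> borel_measurable M"
proof -
  have "(\<lambda>x. cnj (g x)) \<in> borel_measurable M"
    by (rule borel_measurable_continuous_on[OF _ assms]) (intro continuous_intros)
  moreover have "(\<lambda>x. complex_of_real (cmod (g x))) \<in> borel_measurable M"
    by (rule borel_measurable_continuous_on[OF _ assms]) (intro continuous_intros)
  ultimately show ?thesis by measurable
qed

context siegel_kernel
begin

text \<open>For a bounded, compactly supported \<open>f\<close> the image is continuous by dominated convergence,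
  so the almost everywhere bound holds at every point.\<close>

lemma bounded_everywhere:
  assumes C: "\<And>f. f \<in> borel_measurable lborel \<Longrightarrow> mixed_norm_1p k p \<alpha> f < \<infinity> \<Longrightarrow>
      AE x in lborel. x \<in> TB k \<times> TB k \<longrightarrow>
        cmod (int_op k a K f (fst x) (snd x)) \<le> C * enn2real (mixed_norm_1p k p \<alpha> f)"
    and f: "f \<in> borel_measurable borel" and fin: "mixed_norm_1p k p \<alpha> f < \<infinity>"
    and Q: "compact Q" "Q \<subseteq> TB k \<times> TB k"
    and M: "\<And>y. y \<in> Q \<Longrightarrow> cmod (f y) \<le> M" and f0: "\<And>y. y \<notin> Q \<Longrightarrow> f y = 0"
    and zw: "z \<in> TB k" "w \<in> TB k"
  shows "set_integrable lborel (TB k \<times> TB k) (\<lambda>y. K z w (fst y) (snd y) * f y)"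
    "cmod (int_op k a K f z w) \<le> C * enn2real (mixed_norm_1p k p \<alpha> f)"
proof -
  let ?U = "TB k \<times> TB k"
  let ?\<Phi> = "\<lambda>x y. indicator ?U y *\<^sub>R (K (fst x) (snd x) (fst y) (snd y) * f y)"
  have U: "open ?U" by (intro open_Times open_TB)
  have x0: "(z, w) \<in> ?U" using zw by simp
  obtain r where r: "r > 0" "cball (z, w) r \<subseteq> ?U"
    using U x0 open_contains_cball by blast
  \<comment> \<open>The exceptional set is null, so every ball contains a point where the bound
    holds; such points are chosen converging to (z, w).\<close>
  have "\<exists>x. x \<in> ball (z, w) (r / real (Suc n)) \<and>
      (x \<in> ?U \<longrightarrow> cmod (int_op k a K f (fst x) (snd x)) \<le> C * enn2real (mixed_norm_1p k p \<alpha> f))" for n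
  proof -
    have "0 < r / real (Suc n)" using r by simp
    then have "ball (z, w) (r / real (Suc n)) \<noteq> {}" by simp
    then show ?thesis using AE_lborel_open_ex[OF C[OF _ fin] open_ball] f by (simp only: Bex_def) simp
  qed
  then obtain X where X: "\<And>n. X n \<in> ball (z, w) (r / real (Suc n))"
    "\<And>n. X n \<in> ?U \<Longrightarrow> cmod (int_op k a K f (fst (X n)) (snd (X n))) \<le> C * enn2real (mixed_norm_1p k p \<alpha> f)"
    by metis
  have Xc: "X n \<in> cball (z, w) r" for n
  proof -
    have "r / real (Suc n) \<le> r / 1" using r by (intro divide_left_mono) auto
    then show ?thesis using X(1)[of n] by auto
  qed
  then have XU: "X n \<in> ?U" for n using r by blast
  have Xlim: "X \<longlonglongrightarrow> (z, w)"
  proof (rule metric_tendsto_imp_tendsto)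
    show "(\<lambda>n. r / real (Suc n)) \<longlonglongrightarrow> 0" by (rule LIMSEQ_Suc[OF lim_const_over_n])
    show "\<forall>\<^sub>F n in sequentially. dist (X n) (z, w) \<le> dist (r / real (Suc n)) 0"
      using X(1) r by (auto simp: dist_commute intro!: always_eventually less_imp_le)
  qed
  let ?\<kappa> = "\<lambda>x. K (fst (fst x)) (snd (fst x)) (fst (snd x)) (snd (snd x))"
  \<comment> \<open>Compactness in both arguments bounds the kernel uniformly for parameters near
    (z, w), which provides the dominating function \<open>B * M\<close> on \<open>Q\<close>.\<close>
  have "compact (?\<kappa> ` (cball (z, w) r \<times> Q))"
    using r Q by (intro compact_continuous_image continuous_on_subset[OF continuous_on_K] compact_Times) auto
  then obtain B where B: "\<And>x y. x \<in> cball (z, w) r \<Longrightarrow> y \<in> Q \<Longrightarrow> cmod (?\<kappa> (x, y)) \<le> B"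
    by (metis (no_types, lifting) bounded_iff compact_imp_bounded image_eqI mem_Sigma_iff)
  have dom: "norm (?\<Phi> x y) \<le> B * M * indicator Q y" if "x \<in> cball (z, w) r" for x y
  proof (cases "y \<in> Q")
    case True
    have "0 \<le> M" "0 \<le> B" using M[OF True] B[OF that True] norm_ge_zero order_trans by blast+
    then have "cmod (K (fst x) (snd x) (fst y) (snd y)) * cmod (f y) \<le> B * M"
      using B[OF that True] M[OF True] by (intro mult_mono) auto
    then show ?thesis using True Q by (auto simp: norm_mult)
  qed (simp add: f0)
  have meas: "?\<Phi> x \<in> borel_measurable lborel" if "x \<in> ?U" for x
    using measurable_K_mult[OF f, of "fst x" "snd x"] that by auto
  have intQ: "integrable lborel (\<lambda>y. B * M * indicator Q y)"
    using Q emeasure_compact_finite[OF Q(1)]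
    by (intro integrable_mult_right integrable_real_indicator) (auto intro: borel_compact)
  have lim: "(\<lambda>n. ?\<Phi> (X n) y) \<longlonglongrightarrow> ?\<Phi> (z, w) y" for y
  proof (cases "y \<in> ?U")
    case True
    have "(\<lambda>n. ?\<kappa> (X n, y)) \<longlonglongrightarrow> ?\<kappa> ((z, w), y)"
      by (rule continuous_on_tendsto_compose[OF continuous_on_K])
        (use True XU zw Xlim in \<open>auto intro!: tendsto_Pair simp: mem_Times_iff\<close>)
    then show ?thesis using True by (auto intro!: tendsto_intros)
  qed simp
  show int: "set_integrable lborel ?U (\<lambda>y. K z w (fst y) (snd y) * f y)"
    unfolding set_integrable_def
    by (rule Bochner_Integration.integrable_bound[OF intQ])
      (use meas[OF x0] dom[of "(z, w)"] r in \<open>auto intro!: AE_I2 intro: order_trans[OF _ abs_ge_self]\<close>)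
  have L1: "(\<lambda>n. integral\<^sup>L lborel (?\<Phi> (X n))) \<longlonglongrightarrow> integral\<^sup>L lborel (?\<Phi> (z, w))"
    by (rule integral_dominated_convergence[OF meas[OF x0] meas[OF XU] intQ])
      (use lim dom Xc in \<open>auto intro!: AE_I2\<close>)
  have L2: "(\<lambda>n. rho k (fst (X n)) powr fst a * rho k (snd (X n)) powr snd a)
      \<longlonglongrightarrow> rho k z powr fst a * rho k w powr snd a"
  proof -
    have c: "continuous_on ?U (\<lambda>x. rho k (fst x) powr fst a * rho k (snd x) powr snd a)"
      by (intro continuous_intros) (auto dest: rho_pos)
    show ?thesis using continuous_on_tendsto_compose[OF c Xlim x0] XU by simp
  qed
  have "(\<lambda>n. int_op k a K f (fst (X n)) (snd (X n))) \<longlonglongrightarrow> int_op k a K f z w"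
    unfolding int_op_def set_lebesgue_integral_def
    using tendsto_mult[OF tendsto_of_real[OF L2] L1] by simp
  then have "(\<lambda>n. cmod (int_op k a K f (fst (X n)) (snd (X n)))) \<longlonglongrightarrow> cmod (int_op k a K f z w)"
    by (rule tendsto_norm)
  then show "cmod (int_op k a K f z w) \<le> C * enn2real (mixed_norm_1p k p \<alpha> f)"
    by (rule LIMSEQ_le_const2) (use X(2) XU in auto)
qed

text \<open>Testing against \<open>g\<^sub>1(u) g\<^sub>2(\<eta>)\<close> times the conjugate phase of the kernel at \<open>(z, w)\<close>.\<close>

lemma bounded_tensor:
  assumes p: "p > 1"
    and C: "\<And>f. f \<in> borel_measurable lborel \<Longrightarrow> mixed_norm_1p k p \<alpha> f < \<infinity> \<Longrightarrow>
      AE x in lborel. x \<in> TB k \<times> TB k \<longrightarrow>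
        cmod (int_op k a K f (fst x) (snd x)) \<le> C * enn2real (mixed_norm_1p k p \<alpha> f)"
    and g1 [measurable]: "g1 \<in> borel_measurable borel" and g2 [measurable]: "g2 \<in> borel_measurable borel"
    and Q1: "compact Q1" "Q1 \<subseteq> TB k" and Q2: "compact Q2" "Q2 \<subseteq> TB k"
    and g1M: "\<And>u. 0 \<le> g1 u" "\<And>u. u \<in> Q1 \<Longrightarrow> g1 u \<le> M1" "\<And>u. u \<notin> Q1 \<Longrightarrow> g1 u = 0"
    and g2M: "\<And>u. 0 \<le> g2 u" "\<And>u. u \<in> Q2 \<Longrightarrow> g2 u \<le> M2" "\<And>u. u \<notin> Q2 \<Longrightarrow> g2 u = 0"
    and zw: "z \<in> TB k" "w \<in> TB k"
  shows "ennreal (rho k z powr fst a * rho k w powr snd a) *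
      ((\<integral>\<^sup>+u\<in>TB k. ennreal (kernel_abs k (fst b) (fst c) z u * g1 u) \<partial>lborel)
      * (\<integral>\<^sup>+\<eta>\<in>TB k. ennreal (kernel_abs k (snd b) (snd c) w \<eta> * g2 \<eta>) \<partial>lborel))
    \<le> ennreal \<bar>C\<bar> * ((\<integral>\<^sup>+u\<in>TB k. ennreal (g1 u * rho k u powr fst \<alpha>) \<partial>lborel)
      * ennpow (\<integral>\<^sup>+\<eta>\<in>TB k. ennreal (g2 \<eta> powr p * rho k \<eta> powr snd \<alpha>) \<partial>lborel) (1/p))"
proof -
  let ?U = "TB k \<times> TB k"
  \<comment> \<open>Cutting off outside the domain, where nothing is assumed about \<open>K\<close>,
    makes the kernel Borel on the whole space.\<close>
  define \<kappa> where "\<kappa> y = indicator ?U y *\<^sub>R K z w (fst y) (snd y)" for y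
  have \<kappa>[measurable]: "\<kappa> \<in> borel_measurable borel"
    using measurable_K_mult[of "\<lambda>_. 1", OF _ zw] by (simp add: \<kappa>_def[abs_def])
  \<comment> \<open>The kernel does not vanish on \<open>?U\<close>, so there
    \<open>|f| = g1 g2\<close> and \<open>K f = |K| g1 g2\<close>: the norm of \<open>f\<close>
    factors, and its image at this one point (z, w) is an integral without cancellation.\<close>
  define f where "f y = cnj (\<kappa> y) / complex_of_real (cmod (\<kappa> y)) * complex_of_real (g1 (fst y) * g2 (snd y))" for y
  have [measurable]: "(\<lambda>y::(complex^'n)\<times>(complex^'n). g1 (fst y)) \<in> borel_measurable borel"
    "(\<lambda>y::(complex^'n)\<times>(complex^'n). g2 (snd y)) \<in> borel_measurable borel"
    by (simp_all add: borel_prod[symmetric])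
  have f: "f \<in> borel_measurable borel"
    unfolding f_def by (intro borel_measurable_times borel_measurable_phase \<kappa>) measurable
  have Kpos: "0 < cmod (K z w u \<eta>)" if "u \<in> TB k" "\<eta> \<in> TB k" for u \<eta>
    using zw that by (simp add: cmod_K kernel_abs_pos del: zero_less_norm_iff)
  have cf: "cmod (f (u, \<eta>)) = g1 u * g2 \<eta>" if "u \<in> TB k" "\<eta> \<in> TB k" for u \<eta>
    using Kpos[OF that] that g1M(1)[of u] g2M(1)[of \<eta>] by (simp add: f_def \<kappa>_def norm_mult norm_divide)
  have Kf: "K z w u \<eta> * f (u, \<eta>) = complex_of_real (cmod (K z w u \<eta> * f (u, \<eta>)))"
    if "u \<in> TB k" "\<eta> \<in> TB k" for u \<eta>
  proof -
    have "K z w u \<eta> * f (u, \<eta>) = complex_of_real ((cmod (K z w u \<eta>))\<^sup>2 / cmod (K z w u \<eta>) * (g1 u * g2 \<eta>))"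
      using that complex_norm_square[of "K z w u \<eta>"] by (simp add: f_def \<kappa>_def)
    then show ?thesis
      using Kpos[OF that] g1M(1)[of u] g2M(1)[of \<eta>] by (simp add: norm_mult power2_eq_square)
  qed
  \<comment> \<open>On a compact subset of the domain the weight is bounded whatever the sign of
    \<open>e\<close>. The general form serves both \<open>g1\<close> and
    \<open>g2 powr p\<close>.\<close>
  have w_fin: "\<exists>G\<ge>0. (\<integral>\<^sup>+u\<in>TB k. ennreal (g u * rho k u powr e) \<partial>lborel) = ennreal G"
    if "compact Q" "Q \<subseteq> TB k" "\<And>u. 0 \<le> g u" "\<And>u. u \<in> Q \<Longrightarrow> g u \<le> M" "\<And>u. u \<notin> Q \<Longrightarrow> g u = 0" for g Q M e
  proof -
    have "compact ((\<lambda>u. rho k u powr e) ` Q)"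
      using that by (intro compact_continuous_image continuous_intros) (auto dest!: rho_pos subsetD)
    then obtain D where D: "\<And>u. u \<in> Q \<Longrightarrow> rho k u powr e \<le> D"
      by (meson bounded_imp_bdd_above compact_imp_bounded bdd_above.E imageI)
    have "(\<integral>\<^sup>+u\<in>TB k. ennreal (g u * rho k u powr e) \<partial>lborel) = (\<integral>\<^sup>+u. ennreal (g u * rho k u powr e) \<partial>lborel)"
      using that by (intro nn_integral_cong) (auto split: split_indicator)
    also have "\<dots> < \<infinity>"
    proof (rule nn_integral_compact_support_finite[OF that(1), of _ "M * D"])
      fix u assume u: "u \<in> Q"
      have "0 \<le> M" using that(3)[of u] that(4)[OF u] by linarith
      then show "g u * rho k u powr e \<le> M * D" using that(3,4) D u by (intro mult_mono) auto
    qed (simp add: that)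
    finally show ?thesis by (cases "\<integral>\<^sup>+u\<in>TB k. ennreal (g u * rho k u powr e) \<partial>lborel") auto
  qed
  obtain G1 where G1: "G1 \<ge> 0" "(\<integral>\<^sup>+u\<in>TB k. ennreal (g1 u * rho k u powr fst \<alpha>) \<partial>lborel) = ennreal G1"
    using w_fin[of Q1 g1 M1, OF Q1 g1M] by blast
  have "\<exists>G\<ge>0. (\<integral>\<^sup>+\<eta>\<in>TB k. ennreal (g2 \<eta> powr p * rho k \<eta> powr snd \<alpha>) \<partial>lborel) = ennreal G"
    by (rule w_fin[OF Q2, where M = "M2 powr p"]) (use g2M p in \<open>auto intro!: powr_mono2\<close>)
  then obtain G2 where G2: "G2 \<ge> 0" "(\<integral>\<^sup>+\<eta>\<in>TB k. ennreal (g2 \<eta> powr p * rho k \<eta> powr snd \<alpha>) \<partial>lborel) = ennreal G2"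
    by blast
  have norm_f: "mixed_norm_1p k p \<alpha> f = ennreal (G1 * G2 powr (1/p))"
  proof -
    have inner: "(\<integral>\<^sup>+u\<in>TB k. ennreal (cmod (f (u, \<eta>)) * rho k u powr fst \<alpha>) \<partial>lborel) = ennreal (g2 \<eta> * G1)" if "\<eta> \<in> TB k" for \<eta>
    proof -
      have "(\<integral>\<^sup>+u\<in>TB k. ennreal (cmod (f (u, \<eta>)) * rho k u powr fst \<alpha>) \<partial>lborel)
         = (\<integral>\<^sup>+u. ennreal (g2 \<eta>) * (ennreal (g1 u * rho k u powr fst \<alpha>) * indicator (TB k) u) \<partial>lborel)"
        using that g2M(1)[of \<eta>]
        by (intro nn_integral_cong) (auto simp: cf ennreal_mult'[symmetric] mult_ac split: split_indicator)
      also have "\<dots> = ennreal (g2 \<eta>) * ennreal G1"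
        by (subst nn_integral_cmult) (auto simp: G1)
      finally show ?thesis using g2M(1) by (simp add: ennreal_mult')
    qed
    have "(\<integral>\<^sup>+\<eta>\<in>TB k. ennpow (\<integral>\<^sup>+u\<in>TB k. ennreal (cmod (f (u, \<eta>)) * rho k u powr fst \<alpha>) \<partial>lborel) p
          * ennreal (rho k \<eta> powr snd \<alpha>) \<partial>lborel)
       = (\<integral>\<^sup>+\<eta>. ennreal (G1 powr p) * (ennreal (g2 \<eta> powr p * rho k \<eta> powr snd \<alpha>) * indicator (TB k) \<eta>) \<partial>lborel)"
    proof (rule nn_integral_cong)
      fix \<eta> :: "complex^'n"
      have "(g2 \<eta> * G1) powr p * rho k \<eta> powr snd \<alpha> = G1 powr p * (g2 \<eta> powr p * rho k \<eta> powr snd \<alpha>)"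
        using g2M(1)[of \<eta>] G1 by (simp add: powr_mult)
      then show "ennpow (\<integral>\<^sup>+u\<in>TB k. ennreal (cmod (f (u, \<eta>)) * rho k u powr fst \<alpha>) \<partial>lborel) p
          * ennreal (rho k \<eta> powr snd \<alpha>) * indicator (TB k) \<eta>
        = ennreal (G1 powr p) * (ennreal (g2 \<eta> powr p * rho k \<eta> powr snd \<alpha>) * indicator (TB k) \<eta>)"
        using inner[of \<eta>] g2M(1)[of \<eta>] G1
        by (cases "\<eta> \<in> TB k") (simp_all add: ennpow_ennreal ennreal_mult'[symmetric])
    qed
    also have "\<dots> = ennreal (G1 powr p * G2)"
      using G2 by (subst nn_integral_cmult) (auto simp: ennreal_mult'')
    finally show ?thesis unfolding mixed_norm_1p_def
      using G1 G2 p by (simp add: ennpow_ennreal powr_mult powr_powr)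
  qed
  have fin: "mixed_norm_1p k p \<alpha> f < \<infinity>" by (simp add: norm_f)
  have f_out: "f y = 0" if "y \<notin> Q1 \<times> Q2" for y
    using that g1M(3) g2M(3) by (cases y) (auto simp: f_def)
  have f_in: "cmod (f y) \<le> M1 * M2" if yQ: "y \<in> Q1 \<times> Q2" for y
  proof -
    obtain u \<eta> where y: "y = (u, \<eta>)" "u \<in> Q1" "\<eta> \<in> Q2" using yQ by auto
    then have "cmod (f y) = g1 u * g2 \<eta>" using Q1 Q2 by (auto intro: cf)
    also have "\<dots> \<le> M1 * M2"
      using y g1M(1)[of u] g1M(2)[of u] g2M(1)[of \<eta>] g2M(2)[of \<eta>] by (intro mult_mono) auto
    finally show ?thesis .
  qed
  have "compact (Q1 \<times> Q2)" "Q1 \<times> Q2 \<subseteq> ?U" using Q1 Q2 by (auto intro: compact_Times)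
  note bd = bounded_everywhere[OF C f fin this f_in f_out zw]
  \<comment> \<open>The integrand equals its own modulus, so the modulus of the integral becomes a
    nonnegative integral, to which Tonelli applies.\<close>
  define \<psi> where "\<psi> y = cmod (indicator ?U y *\<^sub>R (K z w (fst y) (snd y) * f y))" for y
  have \<psi>: "indicator ?U y *\<^sub>R (K z w (fst y) (snd y) * f y) = complex_of_real (\<psi> y)" for y
  proof (cases "y \<in> ?U")
    case True
    then show ?thesis using Kf[of "fst y" "snd y"] by (auto simp: \<psi>_def)
  qed (simp add: \<psi>_def)
  have \<psi>0: "0 \<le> \<psi> y" for y by (simp add: \<psi>_def)
  have int\<psi>: "integrable lborel \<psi>"
    using bd(1) unfolding set_integrable_def \<psi> by (simp add: complex_of_real_integrable_eq)
  have "cmod (int_op k a K f z w) = (rho k z powr fst a * rho k w powr snd a) * integral\<^sup>L lborel \<psi>"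
    unfolding int_op_def set_lebesgue_integral_def \<psi>
    by (simp add: norm_mult abs_of_nonneg[OF Bochner_Integration.integral_nonneg] \<psi>0)
  then have "ennreal (cmod (int_op k a K f z w)) = ennreal (rho k z powr fst a * rho k w powr snd a) * (\<integral>\<^sup>+y. ennreal (\<psi> y) \<partial>lborel)"
    using nn_integral_eq_integral[OF int\<psi>] \<psi>0 by (simp add: ennreal_mult')
  also have "(\<integral>\<^sup>+y. ennreal (\<psi> y) \<partial>lborel)
      = (\<integral>\<^sup>+\<eta>\<in>TB k. (\<integral>\<^sup>+u\<in>TB k. ennreal (kernel_abs k (fst b) (fst c) z u * cmod (f (u, \<eta>))) \<partial>lborel)
        * ennreal (kernel_abs k (snd b) (snd c) w \<eta>) \<partial>lborel)"
    unfolding \<psi>_def by (rule nn_integral_K[OF f zw])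
  also have "\<dots> = (\<integral>\<^sup>+\<eta>. (\<integral>\<^sup>+u\<in>TB k. ennreal (kernel_abs k (fst b) (fst c) z u * g1 u) \<partial>lborel)
        * (ennreal (kernel_abs k (snd b) (snd c) w \<eta> * g2 \<eta>) * indicator (TB k) \<eta>) \<partial>lborel)"
  proof (rule nn_integral_cong)
    fix \<eta> :: "complex^'n"
    have "(\<integral>\<^sup>+u\<in>TB k. ennreal (kernel_abs k (fst b) (fst c) z u * cmod (f (u, \<eta>))) \<partial>lborel)
       = (\<integral>\<^sup>+u\<in>TB k. ennreal (kernel_abs k (fst b) (fst c) z u * g1 u) \<partial>lborel) * ennreal (g2 \<eta>)" if "\<eta> \<in> TB k"
    proof -
      have "(\<integral>\<^sup>+u\<in>TB k. ennreal (kernel_abs k (fst b) (fst c) z u * cmod (f (u, \<eta>))) \<partial>lborel)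
        = (\<integral>\<^sup>+u. (ennreal (kernel_abs k (fst b) (fst c) z u * g1 u) * indicator (TB k) u) * ennreal (g2 \<eta>) \<partial>lborel)"
        using that g1M(1) g2M(1)[of \<eta>]
        by (intro nn_integral_cong) (auto simp: cf ennreal_mult'' mult.assoc split: split_indicator)
      then show ?thesis by (subst (asm) nn_integral_multc) auto
    qed
    then show "(\<integral>\<^sup>+u\<in>TB k. ennreal (kernel_abs k (fst b) (fst c) z u * cmod (f (u, \<eta>))) \<partial>lborel)
        * ennreal (kernel_abs k (snd b) (snd c) w \<eta>) * indicator (TB k) \<eta>
      = (\<integral>\<^sup>+u\<in>TB k. ennreal (kernel_abs k (fst b) (fst c) z u * g1 u) \<partial>lborel)
        * (ennreal (kernel_abs k (snd b) (snd c) w \<eta> * g2 \<eta>) * indicator (TB k) \<eta>)"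
      using g2M(1)[of \<eta>] by (cases "\<eta> \<in> TB k") (simp_all add: ennreal_mult'' mult_ac)
  qed
  also have "\<dots> = (\<integral>\<^sup>+u\<in>TB k. ennreal (kernel_abs k (fst b) (fst c) z u * g1 u) \<partial>lborel)
      * (\<integral>\<^sup>+\<eta>\<in>TB k. ennreal (kernel_abs k (snd b) (snd c) w \<eta> * g2 \<eta>) \<partial>lborel)"
    by (subst nn_integral_cmult) auto
  finally have "ennreal (rho k z powr fst a * rho k w powr snd a) *
      ((\<integral>\<^sup>+u\<in>TB k. ennreal (kernel_abs k (fst b) (fst c) z u * g1 u) \<partial>lborel)
      * (\<integral>\<^sup>+\<eta>\<in>TB k. ennreal (kernel_abs k (snd b) (snd c) w \<eta> * g2 \<eta>) \<partial>lborel)) = ennreal (cmod (int_op k a K f z w))"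
    by simp
  \<comment> \<open>\<open>C\<close> is an arbitrary real, possibly negative;
    \<open>\<bar>C\<bar>\<close> lets the bound be split into factors under
    \<open>ennreal\<close>.\<close>
  also have "\<dots> \<le> ennreal (\<bar>C\<bar> * (G1 * G2 powr (1/p)))"
  proof (rule ennreal_leI)
    have "0 \<le> G1 * G2 powr (1/p)" using G1 by simp
    then have "C * (G1 * G2 powr (1/p)) \<le> \<bar>C\<bar> * (G1 * G2 powr (1/p))" by (intro mult_right_mono) auto
    then show "cmod (int_op k a K f z w) \<le> \<bar>C\<bar> * (G1 * G2 powr (1/p))"
      using bd(2) \<open>0 \<le> G1 * G2 powr (1/p)\<close> by (simp add: norm_f)
  qed
  finally show ?thesis
    unfolding G1 G2 using G1(1) G2(1) by (simp add: ennpow_ennreal ennreal_mult')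
qed

end

section \<open>Exponents from bounds on powers\<close>

lemma powr_bounded_imp_nonpos:
  fixes e C :: real
  assumes "\<And>x. 1 \<le> x \<Longrightarrow> x powr e \<le> C"
  shows "e \<le> 0"
proof (rule ccontr)
  assume e: "\<not> e \<le> 0"
  have "1 \<le> (\<bar>C\<bar> + 2) powr (1/e)" using e by (intro ge_one_powr_ge_zero) auto
  from assms[OF this] have "\<bar>C\<bar> + 2 \<le> C" using e by (simp add: powr_powr)
  then show False by linarith
qed

lemma powr_bounded_imp_nonneg:
  fixes e C :: real
  assumes "\<And>x. 0 < x \<Longrightarrow> x \<le> 1 \<Longrightarrow> x powr e \<le> C"
  shows "0 \<le> e"
proof -
  have "x powr (-e) \<le> C" if "1 \<le> x" for x
    using assms[of "1 / x"] that by (simp add: powr_divide powr_minus_divide)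
  from powr_bounded_imp_nonpos[of "-e", OF this] show ?thesis by simp
qed

lemma powr_bounded_imp_zero:
  fixes e C :: real
  assumes "\<And>x. 0 < x \<Longrightarrow> x powr e \<le> C"
  shows "e = 0"
  using powr_bounded_imp_nonpos[of e C] powr_bounded_imp_nonneg[of e C] assms by force

text \<open>Uniform in \<open>s\<close> for either sign of \<open>e\<close>: one height may tend to
  0 while the other stays 1, and the modulus of the kernel does not interfere.\<close>

lemma half_sum_powr_le:
  fixes s e :: real
  assumes "0 < s" "s \<le> 1"
  shows "((1 + s) / 2) powr e \<le> 1 + (1/2) powr e"
proof (cases "e \<ge> 0")
  case True
  have "((1 + s) / 2) powr e \<le> 1 powr e" using True assms by (intro powr_mono2) auto
  then show ?thesis by (simp add: add_increasing2)
next
  case False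
  have "((1 + s) / 2) powr e \<le> (1/2) powr e" using False assms by (intro powr_mono2') auto
  then show ?thesis by simp
qed

text \<open>The points \<open>(0, ..., 0, i t)\<close>, with \<open>k\<close> as last index. Between
  two of them \<open>rho2\<close> is the real number \<open>(t + s) / 2\<close>, so bounds on the
  kernel become inequalities in two positive reals.\<close>

definition axis_point :: "'n::finite \<Rightarrow> real \<Rightarrow> complex^'n" where
  "axis_point k t = axis k (Complex 0 t)"

lemma axis_point_nth: "axis_point k t $ k = Complex 0 t" "j \<noteq> k \<Longrightarrow> axis_point k t $ j = 0"
  by (simp_all add: axis_point_def axis_def)

lemma rho_axis_point [simp]: "rho k (axis_point k t) = t"
  unfolding rho_def by (subst sum.neutral) (auto simp: axis_point_nth)

lemma axis_point_in_TB [simp]: "axis_point k t \<in> TB k \<longleftrightarrow> 0 < t"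
  by (simp add: TB_def)

lemma rho2_axis_point: "rho2 k (axis_point k t) (axis_point k s) = complex_of_real ((t + s) / 2)"
proof (rule complex_eqI)
  show "Re (rho2 k (axis_point k t) (axis_point k s)) = Re (complex_of_real ((t + s) / 2))"
    unfolding Re_rho2 by (subst sum.neutral) (auto simp: axis_point_nth)
  show "Im (rho2 k (axis_point k t) (axis_point k s)) = Im (complex_of_real ((t + s) / 2))"
    unfolding Im_rho2 by (subst sum.neutral) (auto simp: axis_point_nth)
qed

lemma kernel_abs_axis_point:
  assumes "0 < s" "0 < t"
  shows "kernel_abs k b c (axis_point k t) (axis_point k s) = s powr b * ((t + s) / 2) powr (-c)"
  using assms by (simp add: kernel_abs_def rho2_axis_point del: of_real_divide of_real_add)

text \<open>Test on axis points of heights \<open>t\<close> and \<open>s\<close>: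
  \<open>t = 1\<close> with small \<open>s\<close> bounds \<open>s powr (b - \<alpha>)\<close>, the
  reversed roles bound the power with exponent \<open>a\<close>, and \<open>t = s\<close> at all
  scales forces homogeneity, which is the formula for \<open>c\<close>.\<close>

lemma exponents_of_pointwise_bound:
  fixes k :: "'n::finite"
  assumes "\<And>z u. z \<in> TB k \<Longrightarrow> u \<in> TB k \<Longrightarrow> rho k z powr a * kernel_abs k b c z u \<le> D * rho k u powr \<alpha>"
  shows "a \<ge> 0" "b \<ge> \<alpha>" "c = a + b - \<alpha>"
proof -
  have D: "t powr a * s powr (b - \<alpha>) \<le> D * ((t + s) / 2) powr c" if "t > 0" "s > 0" for t s
  proof -
    have "t powr a * (s powr b * ((t + s) / 2) powr (-c)) \<le> D * s powr \<alpha>"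
      using assms[of "axis_point k t" "axis_point k s"] that by (simp add: kernel_abs_axis_point)
    then have le: "t powr a * (s powr b * ((t + s) / 2) powr (-c)) * (s powr (-\<alpha>) * ((t + s) / 2) powr c)
        \<le> D * s powr \<alpha> * (s powr (-\<alpha>) * ((t + s) / 2) powr c)"
      by (intro mult_right_mono) auto
    have e: "s powr \<alpha> * s powr (-\<alpha>) = 1" "((t + s) / 2) powr (-c) * ((t + s) / 2) powr c = 1"
      "s powr b * s powr (-\<alpha>) = s powr (b - \<alpha>)"
      using that by (simp_all add: powr_add[symmetric])
    have l: "t powr a * (s powr b * ((t + s) / 2) powr (-c)) * (s powr (-\<alpha>) * ((t + s) / 2) powr c)
        = t powr a * (s powr b * s powr (-\<alpha>)) * (((t + s) / 2) powr (-c) * ((t + s) / 2) powr c)"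
      by (simp only: mult_ac)
    have r: "D * s powr \<alpha> * (s powr (-\<alpha>) * ((t + s) / 2) powr c)
        = D * ((t + s) / 2) powr c * (s powr \<alpha> * s powr (-\<alpha>))"
      by (simp only: mult_ac)
    show ?thesis using le unfolding l r e by simp
  qed
  have D0: "D \<ge> 0" using D[of 1 1] by simp
  have le: "D * ((1 + s) / 2) powr c \<le> D * (1 + (1/2) powr c)" if "0 < s" "s \<le> 1" for s
    using half_sum_powr_le[OF that] D0 by (intro mult_left_mono) auto
  have "0 \<le> b - \<alpha>"
  proof (rule powr_bounded_imp_nonneg)
    fix s :: real assume "0 < s" "s \<le> 1"
    then show "s powr (b - \<alpha>) \<le> D * (1 + (1/2) powr c)" using D[of 1 s] le[of s] by simp
  qed
  then show "b \<ge> \<alpha>" by simp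
  show "0 \<le> a"
  proof (rule powr_bounded_imp_nonneg)
    fix s :: real assume "0 < s" "s \<le> 1"
    then show "s powr a \<le> D * (1 + (1/2) powr c)" using D[of s 1] le[of s] by (simp add: add.commute)
  qed
  have "a + (b - \<alpha>) - c = 0"
  proof (rule powr_bounded_imp_zero)
    fix t :: real assume t: "0 < t"
    have "t powr (a + (b - \<alpha>) - c) = t powr a * t powr (b - \<alpha>) / t powr c"
      by (simp add: powr_add powr_diff)
    then show "t powr (a + (b - \<alpha>) - c) \<le> D"
      using D[OF t t] t by (simp add: pos_divide_le_eq)
  qed
  then show "c = a + b - \<alpha>" by simp
qed

lemma sets_cball [measurable]: "cball x r \<in> sets borel"
  by (intro borel_closed closed_cball)

lemma TB_cball:
  assumes "u \<in> TB k"
  obtains r where "r > 0" "cball u r \<subseteq> TB k"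
  using open_TB[of k] assms open_contains_cball by metis

lemma kernel_test_pos_finite:
  assumes z: "z \<in> TB k" and r: "r > 0" "cball u r \<subseteq> TB k"
  shows "0 < (\<integral>\<^sup>+v\<in>TB k. ennreal (kernel_abs k b c z v * indicator (cball u r) v) \<partial>lborel)"
    "(\<integral>\<^sup>+v\<in>TB k. ennreal (kernel_abs k b c z v * indicator (cball u r) v) \<partial>lborel) < \<infinity>"
proof -
  let ?h = "\<lambda>v. kernel_abs k b c z v * indicator (cball u r) v"
  have eq: "(\<integral>\<^sup>+v\<in>TB k. ennreal (?h v) \<partial>lborel) = (\<integral>\<^sup>+v. ennreal (?h v) \<partial>lborel)"
    using r by (intro nn_integral_cong) (auto split: split_indicator)
  have "compact (kernel_abs k b c z ` cball u r)"
    by (intro compact_continuous_image continuous_on_subset[OF continuous_on_kernel_abs[OF z] r(2)]) simp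
  then obtain D where D: "\<And>v. v \<in> cball u r \<Longrightarrow> kernel_abs k b c z v \<le> D"
    by (meson bounded_imp_bdd_above compact_imp_bounded bdd_above.E imageI)
  show "(\<integral>\<^sup>+v\<in>TB k. ennreal (?h v) \<partial>lborel) < \<infinity>"
    unfolding eq by (rule nn_integral_compact_support_finite[of "cball u r" _ D]) (use D in auto)
  show "0 < (\<integral>\<^sup>+v\<in>TB k. ennreal (?h v) \<partial>lborel)"
  proof (rule ccontr)
    assume "\<not> ?thesis"
    then have "(\<integral>\<^sup>+v. ennreal (?h v) \<partial>lborel) = 0" unfolding eq by simp
    moreover have "(\<lambda>v. ennreal (?h v)) \<in> borel_measurable lborel" by measurable
    ultimately have "AE v in lborel. ennreal (?h v) = 0" using nn_integral_0_iff_AE by blast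
    from AE_lborel_open_ex[OF this open_ball, of u r] r obtain v where "v \<in> ball u r" "ennreal (?h v) = 0"
      by auto
    then show False using kernel_abs_pos[OF z, of v b c] r by (auto simp: subset_iff)
  qed
qed

section \<open>Necessity in each variable, and the equivalence\<close>

context siegel_kernel
begin

text \<open>The second variable is frozen at \<open>w\<close>, tested by the ball indicator
  \<open>g2\<close>. What remains is an inequality between integrals over arbitrary balls in
  \<open>u\<close>, which continuity localises to a pointwise bound.\<close>

lemma bounded_imp_exponents_fst:
  assumes p: "p > 1"
    and C: "\<And>f. f \<in> borel_measurable lborel \<Longrightarrow> mixed_norm_1p k p \<alpha> f < \<infinity> \<Longrightarrow>
      AE x in lborel. x \<in> TB k \<times> TB k \<longrightarrow>
        cmod (int_op k a K f (fst x) (snd x)) \<le> C * enn2real (mixed_norm_1p k p \<alpha> f)"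
  shows "fst a \<ge> 0" "fst b \<ge> fst \<alpha>" "fst c = fst a + fst b - fst \<alpha>"
proof -
  define w where "w = axis_point k 1"
  have w: "w \<in> TB k" by (simp add: w_def)
  obtain r where r: "r > 0" "cball w r \<subseteq> TB k" using TB_cball[OF w] .
  define g2 :: "complex^'n \<Rightarrow> real" where "g2 = indicator (cball w r)"
  define X2 where "X2 = (\<integral>\<^sup>+\<eta>\<in>TB k. ennreal (kernel_abs k (snd b) (snd c) w \<eta> * g2 \<eta>) \<partial>lborel)"
  define G2 where "G2 = ennpow (\<integral>\<^sup>+\<eta>\<in>TB k. ennreal (g2 \<eta> powr p * rho k \<eta> powr snd \<alpha>) \<partial>lborel) (1/p)"
  have "0 < X2" "X2 < \<infinity>"
    unfolding X2_def g2_def using kernel_test_pos_finite[OF w r] by auto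
  then obtain x2 where x2: "X2 = ennreal x2" "x2 > 0" by (cases X2) auto
  have tensor: "ennreal (rho k z powr fst a) * (\<integral>\<^sup>+u\<in>TB k. ennreal (kernel_abs k (fst b) (fst c) z u * g1 u) \<partial>lborel) * X2
      \<le> ennreal \<bar>C\<bar> * (\<integral>\<^sup>+u\<in>TB k. ennreal (g1 u * rho k u powr fst \<alpha>) \<partial>lborel) * G2"
    if "z \<in> TB k" "cball v s \<subseteq> TB k" "g1 = indicator (cball v s)" for z g1 v s
  proof -
    have "ennreal (rho k z powr fst a * rho k w powr snd a) *
        ((\<integral>\<^sup>+u\<in>TB k. ennreal (kernel_abs k (fst b) (fst c) z u * g1 u) \<partial>lborel) * X2)
      \<le> ennreal \<bar>C\<bar> * ((\<integral>\<^sup>+u\<in>TB k. ennreal (g1 u * rho k u powr fst \<alpha>) \<partial>lborel) * G2)"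
      unfolding X2_def G2_def
      by (rule bounded_tensor[OF p C, of g1 g2 "cball v s" "cball w r" 1 1])
        (use that r w in \<open>auto simp: g2_def intro!: borel_measurable_indicator borel_closed\<close>)
    then show ?thesis by (simp add: w_def mult.assoc)
  qed
  \<comment> \<open>With exponent 0, \<open>kernel_abs k (snd \<alpha>) 0 w\<close> is the bare
    weight; \<open>rho2\<close> being nonzero matters here because \<open>0 powr 0\<close> is
    0.\<close>
  have "G2 \<noteq> top"
  proof -
    have "(\<integral>\<^sup>+\<eta>\<in>TB k. ennreal (g2 \<eta> powr p * rho k \<eta> powr snd \<alpha>) \<partial>lborel)
       = (\<integral>\<^sup>+\<eta>\<in>TB k. ennreal (kernel_abs k (snd \<alpha>) 0 w \<eta> * g2 \<eta>) \<partial>lborel)"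
      using rho2_nonzero[OF w] rho_pos
      by (intro nn_integral_cong) (auto simp: g2_def kernel_abs_def split: split_indicator)
    also have "\<dots> < \<infinity>" unfolding g2_def by (rule kernel_test_pos_finite[OF w r])
    finally show ?thesis by (simp add: G2_def ennpow_def)
  qed
  then obtain G where G: "G2 = ennreal G" "G \<ge> 0" by (cases G2) auto
  define D where "D = \<bar>C\<bar> * G / x2"
  have D: "D \<ge> 0" using G x2 by (simp add: D_def)
  have bound: "rho k z powr fst a * kernel_abs k (fst b) (fst c) z u \<le> D * rho k u powr fst \<alpha>"
    if z: "z \<in> TB k" and u: "u \<in> TB k" for z u
  proof (rule ccontr)
    assume gt: "\<not> ?thesis"
    \<comment> \<open>If the bound fails at \<open>u\<close>, by continuity it fails on a ball
      around \<open>u\<close>; integrating the strict inequality over that ball contradicts the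
      tensor estimate.\<close>
    define V where "V = TB k \<inter> (\<lambda>v. rho k z powr fst a * kernel_abs k (fst b) (fst c) z v - D * rho k v powr fst \<alpha>) -` {0<..}"
    have "continuous_on (TB k) (\<lambda>v. rho k z powr fst a * kernel_abs k (fst b) (fst c) z v - D * rho k v powr fst \<alpha>)"
      using z by (intro continuous_intros continuous_on_kernel_abs) (auto dest: rho_pos)
    then have "open V"
      unfolding V_def by (rule continuous_open_preimage[OF _ open_TB]) simp
    moreover have "u \<in> V" using gt u by (simp add: V_def)
    ultimately obtain s where s: "s > 0" "cball u s \<subseteq> V"
      unfolding open_contains_cball by blast
    then have sT: "cball u s \<subseteq> TB k" by (auto simp: V_def)
    define g1 :: "complex^'n \<Rightarrow> real" where "g1 = indicator (cball u s)"
    have [measurable]: "g1 \<in> borel_measurable borel" unfolding g1_def by measurable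
    define L where "L v = ennreal (rho k z powr fst a) * (ennreal (kernel_abs k (fst b) (fst c) z v * g1 v) * indicator (TB k) v)" for v
    define R where "R v = ennreal D * (ennreal (g1 v * rho k v powr fst \<alpha>) * indicator (TB k) v)" for v
    have [measurable]: "L \<in> borel_measurable borel" "R \<in> borel_measurable borel"
      unfolding L_def R_def by measurable
    have IL: "(\<integral>\<^sup>+v. L v \<partial>lborel) = ennreal (rho k z powr fst a) * (\<integral>\<^sup>+u\<in>TB k. ennreal (kernel_abs k (fst b) (fst c) z u * g1 u) \<partial>lborel)"
      unfolding L_def by (subst nn_integral_cmult) auto
    have IR: "(\<integral>\<^sup>+v. R v \<partial>lborel) = ennreal D * (\<integral>\<^sup>+u\<in>TB k. ennreal (g1 u * rho k u powr fst \<alpha>) \<partial>lborel)"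
      unfolding R_def by (subst nn_integral_cmult) auto
    have "(\<integral>\<^sup>+v. L v \<partial>lborel) * ennreal x2 \<le> (\<integral>\<^sup>+v. R v \<partial>lborel) * ennreal x2"
    proof -
      have "ennreal \<bar>C\<bar> * ennreal G = ennreal D * ennreal x2"
        using x2 G by (simp add: D_def ennreal_mult'[symmetric])
      then have "Y * (ennreal \<bar>C\<bar> * ennreal G) = Y * (ennreal D * ennreal x2)" for Y by simp
      then have "ennreal \<bar>C\<bar> * Y * ennreal G = ennreal D * Y * ennreal x2" for Y
        by (simp only: mult_ac)
      then show ?thesis
        using tensor[OF z sT g1_def] unfolding IL IR x2 G by simp
    qed
    then have "(\<integral>\<^sup>+v. L v \<partial>lborel) \<le> (\<integral>\<^sup>+v. R v \<partial>lborel)"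
      using x2 by (subst (asm) (1 2) mult.commute) (simp add: ennreal_mult_le_mult_iff)
    \<comment> \<open>Strictness survives integration because the smaller side has a finite integral
      and the two sides differ on a set of positive measure.\<close>
    moreover have "(\<integral>\<^sup>+v. R v \<partial>lborel) < (\<integral>\<^sup>+v. L v \<partial>lborel)"
    proof (rule nn_integral_less)
      have RL: "R v < L v" if "v \<in> cball u s" for v
      proof -
        have "D * rho k v powr fst \<alpha> < rho k z powr fst a * kernel_abs k (fst b) (fst c) z v" "v \<in> TB k"
          using s that by (auto simp: V_def)
        then show ?thesis using that D
          by (simp add: R_def L_def g1_def ennreal_mult'[symmetric] ennreal_less_iff)
      qed
      have z0: "R v = 0" "L v = 0" if "v \<notin> cball u s" for v
        using that by (simp_all add: R_def L_def g1_def)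
      show "AE v in lborel. R v \<le> L v"
      proof (rule AE_I2)
        show "R v \<le> L v" for v using RL[of v] z0[of v] by (cases "v \<in> cball u s") auto
      qed
      show "\<not> (AE v in lborel. L v \<le> R v)"
      proof
        assume "AE v in lborel. L v \<le> R v"
        from AE_lborel_open_ex[OF this open_ball, of u s] s obtain v where "v \<in> ball u s" "L v \<le> R v" by auto
        then show False using RL[of v] by auto
      qed
      have "(\<integral>\<^sup>+v\<in>TB k. ennreal (g1 v * rho k v powr fst \<alpha>) \<partial>lborel)
         = (\<integral>\<^sup>+v\<in>TB k. ennreal (kernel_abs k (fst \<alpha>) 0 w v * g1 v) \<partial>lborel)"
        using rho2_nonzero[OF w]
        by (intro nn_integral_cong) (auto simp: g1_def kernel_abs_def split: split_indicator)
      also have "\<dots> < \<infinity>" unfolding g1_def by (rule kernel_test_pos_finite[OF w s(1) sT])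
      finally show "(\<integral>\<^sup>+v. R v \<partial>lborel) \<noteq> \<infinity>" unfolding IR by (auto simp: ennreal_mult_eq_top_iff)
    qed auto
    ultimately show False by simp
  qed
  from exponents_of_pointwise_bound[OF this]
  show "fst a \<ge> 0" "fst b \<ge> fst \<alpha>" "fst c = fst a + fst b - fst \<alpha>" by auto
qed

text \<open>The test function is \<open>h powr (q - 1)\<close>, the equality case of Hoelder. As
  \<open>(q - 1) * p = q\<close>, the pairing and the \<open>p\<close>-th power of the norm are the
  same integral \<open>X\<close>, so \<open>X\<close> is at most a constant times
  \<open>X powr (1/p)\<close>. This bounds \<open>X powr (1/q)\<close> only if \<open>X\<close> is
  finite, which is why \<open>h\<close> is first truncated to compact sets; monotone convergence
  removes the truncation.\<close>

lemma bounded_imp_kernel_integral: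
  assumes p: "p > 1" and q: "q = p / (p - 1)"
    and C: "\<And>f. f \<in> borel_measurable lborel \<Longrightarrow> mixed_norm_1p k p \<alpha> f < \<infinity> \<Longrightarrow>
      AE x in lborel. x \<in> TB k \<times> TB k \<longrightarrow>
        cmod (int_op k a K f (fst x) (snd x)) \<le> C * enn2real (mixed_norm_1p k p \<alpha> f)"
  shows "\<exists>D\<ge>0. \<forall>w\<in>TB k. (\<integral>\<^sup>+\<eta>\<in>TB k. ennreal (rho k \<eta> powr ((snd b - snd \<alpha>) * q + snd \<alpha>)
      * cmod (rho2 k w \<eta>) powr (- (snd c * q))) \<partial>lborel) \<le> ennreal (D * rho k w powr (- (snd a * q)))"
proof -
  have q1: "q > 1" "(q - 1) * p = q" "1 - 1/p = 1/q" using p by (auto simp: q field_simps)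
  define z where "z = axis_point k 1"
  have z: "z \<in> TB k" by (simp add: z_def)
  obtain r where r: "r > 0" "cball z r \<subseteq> TB k" using TB_cball[OF z] .
  define g1 :: "complex^'n \<Rightarrow> real" where "g1 = indicator (cball z r)"
  define X1 where "X1 = (\<integral>\<^sup>+u\<in>TB k. ennreal (kernel_abs k (fst b) (fst c) z u * g1 u) \<partial>lborel)"
  define G1 where "G1 = (\<integral>\<^sup>+u\<in>TB k. ennreal (g1 u * rho k u powr fst \<alpha>) \<partial>lborel)"
  have "0 < X1" "X1 < \<infinity>"
    unfolding X1_def g1_def using kernel_test_pos_finite[OF z r] by auto
  then obtain x1 where x1: "X1 = ennreal x1" "x1 > 0" by (cases X1) auto
  have "G1 = (\<integral>\<^sup>+u\<in>TB k. ennreal (kernel_abs k (fst \<alpha>) 0 z u * g1 u) \<partial>lborel)"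
    unfolding G1_def using rho2_nonzero[OF z]
    by (intro nn_integral_cong) (auto simp: g1_def kernel_abs_def split: split_indicator)
  also have "\<dots> < \<infinity>" unfolding g1_def by (rule kernel_test_pos_finite[OF z r])
  finally obtain G where G: "G1 = ennreal G" "G \<ge> 0" by (cases G1) auto
  define E where "E = \<bar>C\<bar> * G / x1"
  have E: "E \<ge> 0" using G x1 by (simp add: E_def)
  have "(\<integral>\<^sup>+\<eta>\<in>TB k. ennreal (rho k \<eta> powr ((snd b - snd \<alpha>) * q + snd \<alpha>)
      * cmod (rho2 k w \<eta>) powr (- (snd c * q))) \<partial>lborel) \<le> ennreal (E powr q * rho k w powr (- (snd a * q)))"
    if w: "w \<in> TB k" for w
  proof -
    define h where "h = kernel_abs k (snd b - snd \<alpha>) (snd c) w"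
    have [measurable]: "h \<in> borel_measurable borel" unfolding h_def by measurable
    have h0: "h \<eta> \<ge> 0" for \<eta> by (simp add: h_def)
    \<comment> \<open>A compact exhaustion of the domain; \<open>Suc m\<close> keeps the minimal
      height positive already at \<open>m = 0\<close>, where \<open>1 / 0\<close> would be
      0.\<close>
    define Q where "Q m = cball 0 (real m) \<inter> {\<eta>. 1 / real (Suc m) \<le> rho k \<eta>}" for m
    have Qc: "compact (Q m)" for m
      unfolding Q_def by (intro compact_Int_closed closed_Collect_le continuous_intros) auto
    have QT: "Q m \<subseteq> TB k" for m
    proof
      fix \<eta> assume "\<eta> \<in> Q m"
      moreover have "0 < 1 / real (Suc m)" by simp
      ultimately show "\<eta> \<in> TB k" unfolding Q_def TB_def by (smt (verit) IntE mem_Collect_eq)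
    qed
    have Qs [measurable]: "Q m \<in> sets borel" for m using borel_compact[OF Qc] .
    have Qmono: "Q m \<subseteq> Q m'" if "m \<le> m'" for m m'
    proof -
      have "1 / real (Suc m') \<le> 1 / real (Suc m)" using that by (intro divide_left_mono) auto
      then show ?thesis using that unfolding Q_def by (force intro: order_trans)
    qed
    have QU: "\<exists>m. \<eta> \<in> Q m" if \<eta>: "\<eta> \<in> TB k" for \<eta>
    proof -
      obtain m1 where m1: "norm \<eta> \<le> real m1" using real_arch_simple by blast
      obtain m2 where m2: "1 / real (Suc m2) < rho k \<eta>" using reals_Archimedean[OF rho_pos[OF \<eta>]] by (auto simp: inverse_eq_divide)
      have "1 / real (Suc (max m1 m2)) \<le> 1 / real (Suc m2)" by (intro divide_left_mono) auto
      then have "\<eta> \<in> Q (max m1 m2)" using m1 m2 by (auto simp: Q_def)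
      then show ?thesis ..
    qed
    let ?H = "\<lambda>\<eta>. h \<eta> powr q * rho k \<eta> powr snd \<alpha>"
    define X where "X m = (\<integral>\<^sup>+\<eta>. ennreal (?H \<eta>) * indicator (Q m) \<eta> \<partial>lborel)" for m
    have X: "X m \<le> ennreal (E powr q * rho k w powr (- (snd a * q)))" for m
    proof -
      define g2 where "g2 \<eta> = h \<eta> powr (q - 1) * indicator (Q m) \<eta>" for \<eta>
      have [measurable]: "g2 \<in> borel_measurable borel" unfolding g2_def by measurable
      have nz: "\<forall>\<eta>\<in>Q m. h \<eta> \<noteq> 0" "\<forall>\<eta>\<in>Q m. rho k \<eta> \<noteq> 0"
        using kernel_abs_pos[OF w, of _ "snd b - snd \<alpha>" "snd c"] rho_pos[of _ k] QT[of m]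
        unfolding h_def by (metis less_irrefl subsetD)+
      have ch: "continuous_on (Q m) h"
        unfolding h_def by (rule continuous_on_subset[OF continuous_on_kernel_abs[OF w] QT])
      have "compact ((\<lambda>\<eta>. h \<eta> powr (q - 1)) ` Q m)"
        by (intro compact_continuous_image Qc continuous_intros ch nz)
      then obtain M2 where M2: "\<And>\<eta>. \<eta> \<in> Q m \<Longrightarrow> h \<eta> powr (q - 1) \<le> M2"
        by (meson bounded_imp_bdd_above compact_imp_bounded bdd_above.E imageI)
      have Hfin: "X m < \<infinity>"
      proof -
        have "compact (?H ` Q m)"
          by (intro compact_continuous_image Qc continuous_intros ch nz)
        then obtain B where B: "\<And>\<eta>. \<eta> \<in> Q m \<Longrightarrow> ?H \<eta> \<le> B"
          by (meson bounded_imp_bdd_above compact_imp_bounded bdd_above.E imageI)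
        have "X m = (\<integral>\<^sup>+\<eta>. ennreal (?H \<eta> * indicator (Q m) \<eta>) \<partial>lborel)"
          unfolding X_def by (intro nn_integral_cong) (auto split: split_indicator)
        also have "\<dots> < \<infinity>"
          by (rule nn_integral_compact_support_finite[OF Qc[of m], of _ B]) (use B in auto)
        finally show ?thesis .
      qed
      then obtain x where x: "X m = ennreal x" "x \<ge> 0" by (cases "X m") auto
      have e1: "(\<integral>\<^sup>+\<eta>\<in>TB k. ennreal (kernel_abs k (snd b) (snd c) w \<eta> * g2 \<eta>) \<partial>lborel) = X m"
        unfolding X_def
      proof (rule nn_integral_cong)
        fix \<eta> :: "complex^'n"
        have "kernel_abs k (snd b) (snd c) w \<eta> * h \<eta> powr (q - 1) = ?H \<eta>" if "\<eta> \<in> Q m"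
        proof -
          have "kernel_abs k (snd b) (snd c) w \<eta> = h \<eta> * rho k \<eta> powr snd \<alpha>"
            by (simp add: h_def kernel_abs_def powr_add[symmetric])
          moreover have "h \<eta> * h \<eta> powr (q - 1) = h \<eta> powr q"
            using kernel_abs_pos[OF w, of \<eta>] that QT by (auto simp: h_def powr_mult_base)
          ultimately show ?thesis by (simp add: mult_ac)
        qed
        then show "ennreal (kernel_abs k (snd b) (snd c) w \<eta> * g2 \<eta>) * indicator (TB k) \<eta> = ennreal (?H \<eta>) * indicator (Q m) \<eta>"
          using QT[of m] by (auto simp: g2_def split: split_indicator)
      qed
      have e2: "(\<integral>\<^sup>+\<eta>\<in>TB k. ennreal (g2 \<eta> powr p * rho k \<eta> powr snd \<alpha>) \<partial>lborel) = X m"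
        unfolding X_def using QT[of m] q1(2)
        by (intro nn_integral_cong) (auto simp: g2_def powr_powr split: split_indicator)
      have "ennreal (rho k z powr fst a * rho k w powr snd a) *
          (X1 * (\<integral>\<^sup>+\<eta>\<in>TB k. ennreal (kernel_abs k (snd b) (snd c) w \<eta> * g2 \<eta>) \<partial>lborel))
        \<le> ennreal \<bar>C\<bar> * (G1 * ennpow (\<integral>\<^sup>+\<eta>\<in>TB k. ennreal (g2 \<eta> powr p * rho k \<eta> powr snd \<alpha>) \<partial>lborel) (1/p))"
        unfolding X1_def G1_def
        by (rule bounded_tensor[OF p C, of g1 g2 "cball z r" "Q m" 1 M2])
          (use r z w Qc[of m] QT[of m] M2 in \<open>auto simp: g1_def g2_def intro!: borel_measurable_indicator borel_closed\<close>)
      then have "ennreal (rho k w powr snd a * (x1 * x)) \<le> ennreal (\<bar>C\<bar> * (G * x powr (1/p)))"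
        unfolding e1 e2 x x1 G using x x1 G by (simp add: z_def ennpow_ennreal ennreal_mult')
      then have "rho k w powr snd a * (x1 * x) \<le> \<bar>C\<bar> * (G * x powr (1/p))"
        using G x by (simp add: ennreal_le_iff)
      then have le: "rho k w powr snd a * x \<le> E * x powr (1/p)"
        using x1 by (simp add: E_def field_simps)
      have "x \<le> E powr q * rho k w powr (- (snd a * q))"
      proof (cases "x = 0")
        case False
        then have xp: "x > 0" using x by simp
        have "x powr (1/q) = x * x powr (- (1/p))"
          using xp q1(3) by (simp add: powr_mult_base)
        also have "\<dots> = rho k w powr (- snd a) * (rho k w powr snd a * x) * x powr (- (1/p))"
          using rho_pos[OF w] by (simp add: powr_minus)
        also have "\<dots> \<le> rho k w powr (- snd a) * (E * x powr (1/p)) * x powr (- (1/p))"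
          using le by (intro mult_right_mono mult_left_mono) auto
        also have "\<dots> = E * rho k w powr (- snd a)"
          using xp by (simp add: powr_minus)
        finally have "(x powr (1/q)) powr q \<le> (E * rho k w powr (- snd a)) powr q"
          using q1 by (intro powr_mono2) auto
        then show ?thesis using xp q1 E by (simp add: powr_powr powr_mult)
      qed (use E in auto)
      then show ?thesis unfolding x by (rule ennreal_leI)
    qed
    have "(\<integral>\<^sup>+\<eta>\<in>TB k. ennreal (rho k \<eta> powr ((snd b - snd \<alpha>) * q + snd \<alpha>) * cmod (rho2 k w \<eta>) powr (- (snd c * q))) \<partial>lborel)
       = (\<integral>\<^sup>+\<eta>. (SUP m. ennreal (?H \<eta>) * indicator (Q m) \<eta>) \<partial>lborel)"
    proof (rule nn_integral_cong)
      fix \<eta> :: "complex^'n"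
      show "ennreal (rho k \<eta> powr ((snd b - snd \<alpha>) * q + snd \<alpha>) * cmod (rho2 k w \<eta>) powr (- (snd c * q))) * indicator (TB k) \<eta>
        = (SUP m. ennreal (?H \<eta>) * indicator (Q m) \<eta>)"
      proof (cases "\<eta> \<in> TB k")
        case True
        then obtain m where m: "\<eta> \<in> Q m" using QU by blast
        have "(SUP m. ennreal (?H \<eta>) * indicator (Q m) \<eta>) = ennreal (?H \<eta>)"
        proof (rule antisym)
          show "(SUP m. ennreal (?H \<eta>) * indicator (Q m) \<eta>) \<le> ennreal (?H \<eta>)"
            by (rule SUP_least) (auto split: split_indicator)
          show "ennreal (?H \<eta>) \<le> (SUP m. ennreal (?H \<eta>) * indicator (Q m) \<eta>)"
            by (rule SUP_upper2[of m]) (use m in auto)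
        qed
        then show ?thesis using True kernel_abs_powr[OF True w, of "snd b" "snd \<alpha>" "snd c" q] by (simp add: h_def)
      next
        case False
        then have "\<eta> \<notin> Q m" for m using QT by blast
        then show ?thesis using False by simp
      qed
    qed
    also have "\<dots> = (SUP m. X m)"
      unfolding X_def
    proof (rule nn_integral_monotone_convergence_SUP)
      show "incseq (\<lambda>m \<eta>. ennreal (?H \<eta>) * indicator (Q m) \<eta>)"
        using Qmono by (auto simp: incseq_def le_fun_def split: split_indicator)
    qed measurable
    also have "\<dots> \<le> ennreal (E powr q * rho k w powr (- (snd a * q)))"
      by (rule SUP_least) (rule X)
    finally show ?thesis .
  qed
  then show ?thesis by (intro exI[of _ "E powr q"]) auto
qed

text \<open>At the axis point of height \<open>t\<close> the kernel integral is exactly a positive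
  constant times a power of \<open>t\<close>, and it is bounded by a multiple of another power for
  all \<open>t > 0\<close>. So the constant is finite, which gives the strict inequalities for
  \<open>\<beta>\<close> and \<open>\<gamma>\<close>, and the powers agree, which gives
  \<open>snd c\<close> and turns \<open>\<gamma> > n + 1 + \<beta>\<close> into
  \<open>snd a > 0\<close>.\<close>

lemma bounded_imp_exponents_snd:
  assumes p: "p > 1"
    and C: "\<And>f. f \<in> borel_measurable lborel \<Longrightarrow> mixed_norm_1p k p \<alpha> f < \<infinity> \<Longrightarrow>
      AE x in lborel. x \<in> TB k \<times> TB k \<longrightarrow>
        cmod (int_op k a K f (fst x) (snd x)) \<le> C * enn2real (mixed_norm_1p k p \<alpha> f)"
  shows "snd a > 0" "p * (snd b + 1) > snd \<alpha> + 1"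
    "snd c = real CARD('n) + 1 + snd a + snd b - (real CARD('n) + 1 + snd \<alpha>) / p"
proof -
  define q where "q = p / (p - 1)"
  have q: "q > 1" "1/p + 1/q = 1" "q / p = q - 1" using p by (auto simp: q_def field_simps)
  define \<beta> where "\<beta> = (snd b - snd \<alpha>) * q + snd \<alpha>"
  define \<gamma> where "\<gamma> = snd c * q"
  let ?n = "real CARD('n)"
  obtain D where D: "D \<ge> 0" "\<And>w. w \<in> TB k \<Longrightarrow> (\<integral>\<^sup>+\<eta>\<in>TB k. ennreal (rho k \<eta> powr \<beta>
      * cmod (rho2 k w \<eta>) powr (-\<gamma>)) \<partial>lborel) \<le> ennreal (D * rho k w powr (- (snd a * q)))"
    unfolding \<beta>_def \<gamma>_def using bounded_imp_kernel_integral[OF p q_def C] by blast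
  have J: "ennreal (t powr (?n + 1 + \<beta> - \<gamma>)) * (\<integral>\<^sup>+x. model k \<beta> \<gamma> 1 x \<partial>lborel) \<le> ennreal (D * t powr (- (snd a * q)))"
    if "t > 0" for t
    using D(2)[of "axis_point k t"] nn_integral_kernel[of "axis_point k t" k \<beta> \<gamma>] that by simp
  have fin: "(\<integral>\<^sup>+x. model k \<beta> \<gamma> 1 x \<partial>lborel) < \<infinity>"
    using J[of 1] by (auto intro: le_less_trans)
  then obtain j where j: "(\<integral>\<^sup>+x. model k \<beta> \<gamma> 1 x \<partial>lborel) = ennreal j" "j > 0"
    using nn_integral_model_pos[of k \<beta> \<gamma>] by (cases "\<integral>\<^sup>+x. model k \<beta> \<gamma> 1 x \<partial>lborel") auto
  note bg = nn_integral_model_finite_imp[OF fin]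
  have eq: "?n + 1 + \<beta> - \<gamma> + snd a * q = 0"
  proof (rule powr_bounded_imp_zero)
    fix t :: real assume t: "0 < t"
    have "ennreal (t powr (?n + 1 + \<beta> - \<gamma>) * j) \<le> ennreal (D * t powr (- (snd a * q)))"
      using J[OF t] j by (simp add: ennreal_mult'')
    then have "t powr (?n + 1 + \<beta> - \<gamma>) * j \<le> D * t powr (- (snd a * q))"
      using D(1) by (simp add: ennreal_le_iff)
    then have "t powr (?n + 1 + \<beta> - \<gamma>) * t powr (snd a * q) \<le> D / j"
      using t j by (simp add: powr_minus field_simps)
    then show "t powr (?n + 1 + \<beta> - \<gamma> + snd a * q) \<le> D / j" by (simp add: powr_add)
  qed
  have "0 < snd a * q" using eq bg by linarith
  then show "snd a > 0" using q by (simp add: zero_less_mult_iff)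
  have "0 < (\<beta> + 1) * (p - 1)" using bg p by simp
  also have "(\<beta> + 1) * (p - 1) = p * (snd b + 1) - (snd \<alpha> + 1)"
  proof -
    have "q * (p - 1) = p" using p by (simp add: q_def)
    then have "(snd b - snd \<alpha>) * q * (p - 1) = (snd b - snd \<alpha>) * p" by (simp add: mult.assoc)
    then show ?thesis unfolding \<beta>_def by (simp add: algebra_simps)
  qed
  finally show "p * (snd b + 1) > snd \<alpha> + 1" by simp
  have qp: "(?n + 1 + snd \<alpha>) / p * q = (?n + 1 + snd \<alpha>) * (q - 1)"
    using q(3) by (metis times_divide_eq_left times_divide_eq_right)
  have "snd c * q = (?n + 1 + snd a + snd b - (?n + 1 + snd \<alpha>) / p) * q"
    unfolding left_diff_distrib qp using eq by (simp add: \<beta>_def \<gamma>_def algebra_simps)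
  then show "snd c = ?n + 1 + snd a + snd b - (?n + 1 + snd \<alpha>) / p" using q by simp
qed

lemma bounded_iff:
  assumes p: "p > 1"
  shows "bounded_1p_to_Linf k p \<alpha> a K \<longleftrightarrow>
    (fst a \<ge> 0 \<and> snd a > 0 \<and> fst b \<ge> fst \<alpha> \<and> p * (snd b + 1) > snd \<alpha> + 1
     \<and> fst c = fst a + fst b - fst \<alpha>
     \<and> snd c = real CARD('n) + 1 + snd a + snd b - (real CARD('n) + 1 + snd \<alpha>) / p)"
proof
  assume "bounded_1p_to_Linf k p \<alpha> a K"
  then obtain C where C': "\<And>f. f \<in> borel_measurable lborel \<Longrightarrow> mixed_norm_1p k p \<alpha> f < \<infinity> \<Longrightarrow>
      AE x in lborel. x \<in> TB k \<times> TB k \<longrightarrow>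
        set_integrable lborel (TB k \<times> TB k) (\<lambda>y. K (fst x) (snd x) (fst y) (snd y) * f y) \<and>
        cmod (int_op k a K f (fst x) (snd x)) \<le> C * enn2real (mixed_norm_1p k p \<alpha> f)"
    unfolding bounded_1p_to_Linf_def by blast
  have C: "\<And>f. f \<in> borel_measurable lborel \<Longrightarrow> mixed_norm_1p k p \<alpha> f < \<infinity> \<Longrightarrow>
      AE x in lborel. x \<in> TB k \<times> TB k \<longrightarrow>
        cmod (int_op k a K f (fst x) (snd x)) \<le> C * enn2real (mixed_norm_1p k p \<alpha> f)"
    by (rule eventually_mono[OF C']) auto
  show "fst a \<ge> 0 \<and> snd a > 0 \<and> fst b \<ge> fst \<alpha> \<and> p * (snd b + 1) > snd \<alpha> + 1
     \<and> fst c = fst a + fst b - fst \<alpha>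
     \<and> snd c = real CARD('n) + 1 + snd a + snd b - (real CARD('n) + 1 + snd \<alpha>) / p"
    using bounded_imp_exponents_fst[OF p C] bounded_imp_exponents_snd[OF p C] by blast
qed (use bounded_if[OF p] in blast)

end

theorem theorem6p7:
  fixes k :: "'n::finite" and p2 :: real and a b c \<alpha> :: "real \<times> real"
  assumes "1 < p2"
    and "fst \<alpha> > -1" and "snd \<alpha> > -1"
  defines "n \<equiv> real CARD('n)"
  shows "(bounded_1p_to_Linf k p2 \<alpha> a (kerS k b c) \<longleftrightarrow> bounded_1p_to_Linf k p2 \<alpha> a (kerT k b c))
    \<and> (bounded_1p_to_Linf k p2 \<alpha> a (kerT k b c) \<longleftrightarrow>
        (fst a \<ge> 0 \<and> snd a > 0 \<and> fst b \<ge> fst \<alpha> \<and> p2 * (snd b + 1) > snd \<alpha> + 1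
         \<and> fst c = fst a + fst b - fst \<alpha>
         \<and> snd c = n + 1 + snd a + snd b - (n + 1 + snd \<alpha>) / p2))"
  unfolding n_def siegel_kernel.bounded_iff[OF siegel_kernel_kerS assms(1)]
    siegel_kernel.bounded_iff[OF siegel_kernel_kerT assms(1)]
  by (intro conjI refl)

end
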